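(* Let $\{A(t)\}_{t\ge0}$ satisfy the Acquistapace–Terreni conditions on $\mathbb{R}^+$ with associated evolution family $U(t,s)$, suppose $(t,s)\mapsto U(t,s)x$ is Bi-almost automorphic uniformly for $x$ in bounded subsets of $\mathbb{X}$, and suppose $\|U(t,s)\|\le Me^{-\delta(t-s)}$ for $t\ge s\geq 0$ with constants $M,\delta>0$. Let $B(t,s)$, $t\ge s\ge0$, be linear operators on $\mathbb{X}$ such that $B_0(t,s,x):=B(t,s)x$ is a decomposable kernel (as defined in the context), put $\mathcal{B}u(t)=\int_0^tB(t,s)u(s)\,ds$ and $C_B=\sup_{s\ge0}\int_0^s\|B(s,\tau)\|\,d\tau<\infty$. Let $F\in AAA(\mathbb{R}^+\times\mathbb{X}\times\mathbb{X};\mathbb{X})$, $u_0\in\mathbb{X}$, $h:AAA(\mathbb{R}^+;\mathbb{X})\to\mathbb{X}$, $\varrho>0$, and $$\Delta_0=\{y\in AAA(\mathbb{R}^+;\mathbb{X}):\|y-y_0\|_\infty\le\varrho\},\qquad y_0(t):=U(t,0)(u_0+h(0))+\int_0^tU(t,s)F(s,0,0)\,ds .$$ Suppose that $\|y_0\|_\infty\le\varrho$ and that there are positive constants $L_F,L_h$ such that $h$ is $L_h$-Lipschitz on $\Delta_0$ and $$\|F(t,y(t),z(t))-F(t,x(t),w(t))\|\le L_F\big(\|y(t)-x(t)\|+\|z(t)-w(t)\|\big),\qquad y,x,z,w\in\Delta_0,\ t\in\mathbb{R}^+ .$$ Suppose furthermore that $$ML_h+\frac{M}{\delta}(1+C_B)L_F\le\frac{\varrho}{\varrho+\|y_0\|_\infty}.$$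 Then the problem $$u'(t)=A(t)u(t)+F(t,u(t),\mathcal{B}u(t)),\ t\ge0,\qquad u(0)=u_0+h(u),$$ has a unique asymptotically almost automorphic mild solution.
   Context: $\mathbb{X}$ is a Banach space, $\mathbb{R}^+=[0,+\infty)$, $\|\cdot\|_\infty$ is the supremum norm. $AA(\mathbb{R};\mathbb{X})$: bounded continuous $f:\mathbb{R}\to\mathbb{X}$ such that every real sequence has a subsequence $(s_n)$ and a function $\tilde f$ with $\lim_n f(t+s_n)=\tilde f(t)$, $\lim_n\tilde f(t-s_n)=f(t)$ for each $t$. $AA(\mathbb{R}\times\mathbb{Y};\mathbb{X})$: bounded continuous $f:\mathbb{R}\times\mathbb{Y}\to\mathbb{X}$ such that for every bounded $\mathcal{D}\subset\mathbb{Y}$ and every real sequence there are a subsequence $(s_n)$ and $\tilde f$ with $\lim_n f(t+s_n,x)=\tilde f(t,x)$, $\lim_n\tilde f(t-s_n,x)=f(t,x)$, pointwise in $t$, uniformly for $x\in\mathcal{D}$. $C_0(\mathbb{R}^+;\mathbb{X})$: continuous functions with norm tending to $0$ at $+\infty$; $C_0(\mathbb{R}^+\times\mathbb{Y};\mathbb{X})$ (and with target $\mathbb{R}^+$): continuous $\phi$ with $\|\phi(t,y)\|\to0$ as $t\to+\infty$ uniformly on bounded subsets of $\mathbb{Y}$. $AAA(\mathbb{R}^+;\mathbb{X})$ (resp. $AAA(\mathbb{R}^+\times\mathbb{Y};\mathbb{X})$), the asymptotically almost automorphic functions: continuous $g=f+\phi$ with $f\in AA(\mathbb{R};\mathbb{X})$,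 $\phi\in C_0(\mathbb{R}^+;\mathbb{X})$ (resp. $f\in AA(\mathbb{R}\times\mathbb{Y};\mathbb{X})$, $\phi\in C_0(\mathbb{R}^+\times\mathbb{Y};\mathbb{X})$). Acquistapace–Terreni conditions: $A(t):D(A(t))\subset\mathbb{X}\to\mathbb{X}$ are linear and there are constants $\lambda_0\ge0$, $\theta\in(\pi/2,\pi)$, $K_1,K_2\ge0$, $\beta_1,\beta_2\in(0,1]$ with $\beta_1+\beta_2>1$ such that for $t,s\in\mathbb{R}^+$ and $\lambda\in\Sigma_\theta=\{\lambda\in\mathbb{C}\setminus\{0\}:|\arg\lambda|\le\theta\}$: $\Sigma_\theta\cup\{0\}\subset\rho(A(t)-\lambda_0)$, $\|R(\lambda,A(t)-\lambda_0)\|\le\frac{K_1}{1+|\lambda|}$, and $\|(A(t)-\lambda_0)R(\lambda,A(t)-\lambda_0)[R(\lambda_0,A(t))-R(\lambda_0,A(s))]\|\le K_2|t-s|^{\beta_1}|\lambda|^{-\beta_2}$. Under these there is a unique evolution family $U(t,s)$, $t\ge s\ge0$, governing $x'(t)=A(t)x(t)$: bounded operators with $U(t,t)=I$, $U(t,s)U(s,r)=U(t,r)$ for $t\ge s\ge r$, strongly continuous in $(t,s)$. Bi-almost automorphic: a jointly continuous $C(t,s,x)$ such that for every real sequence and every bounded $\mathcal{D}\subset\mathbb{X}$ there is a subsequence $(s_n)$ with $\tilde C(t,s,x):=\lim_n C(t+s_n,s+s_n,x)$ existing and $\lim_n\tilde C(t-s_n,s-s_n,x)=C(t,s,x)$ for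 each $(t,s)$ and uniformly for $x\in\mathcal{D}$; for $U$ this is understood for $t\ge s$ where $U$ is defined. Decomposable kernel: $B_0=B_0^a+B_{0,0}^{\theta_1}$ (where all terms are defined), where - $B_0^a:\mathbb{R}\times\mathbb{R}\times\mathbb{X}\to\mathbb{X}$ is Bi-almost automorphic, and there is a positive function $\lambda_1$ with $\|B_0^a(t+\tau,s+\tau,x)\|\le\lambda_1(t,s)$ for all $t,s,\tau$, uniformly for $x$ in bounded subsets of $\mathbb{X}$, and $\sup_t\int_{-\infty}^t\lambda_1(t,s)ds<\infty$; - $\|B_{0,0}^{\theta_1}(t,s,x)\|\le\theta_1(t,s)\widehat B(s,x)$ with $\theta_1:\mathbb{R}\times\mathbb{R}^+\to\mathbb{R}^+$, $\widehat B\in C_0(\mathbb{R}^+\times\mathbb{X};\mathbb{R}^+)$, $\lim_{t\to\infty}\int_0^T\theta_1(t,s)ds=0$ for all $T>0$, $\sup_{t\ge0}\int_0^t\theta_1(t,s)ds<\infty$; - there are $\nu_1,\tilde\nu_1:\mathbb{R}\times\mathbb{R}\to\mathbb{R}^+$ with $\|B_0^a(t,s,u)-B_0^a(t,s,v)\|\le\nu_1(t,s)\|u-v\|$ for $u,v$ in bounded subsets, and the same for the limit functions $\tilde B_0^a$ with $\tilde\nu_1$, $\sup_{t\ge0}\int_{-\infty}^t\nu_1(t,s)ds<\infty$, and $\lim_{t\to\infty}\int_a^b\nu_1(t,s)ds=0$ for every compact $[a,b]\subset\mathbb{R}$; - there is $\vartheta:\mathbb{R}\times\mathbb{R}\to\mathbb{R}^+$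 with $\|B_0^a(t,s,0)\|\le\vartheta(t,s)$ and $\lim_{t\to\infty}\int_{-\infty}^0\vartheta(t,s)ds=0$. Mild solution: a continuous $u:[0,+\infty)\to\mathbb{X}$ with $u(t)=U(t,0)(u_0+h(u))+\int_0^tU(t,s)F(s,u(s),\mathcal{B}u(s))\,ds$. $h$ is $L_h$-Lipschitz on $\Delta_0$: $\|h(x)-h(y)\|\le L_h\|x-y\|_\infty$ for $x,y\in\Delta_0$.
   Formalization: The Lipschitz condition on F is assumed for z,w in Δ_0 ∪ 𝓑(Δ_0), not only Δ_0; existence and uniqueness are asserted within Δ_0; the integrals defining 𝓑u and the mild solution are assumed to exist for u in Δ_0. As stated, with no control off Δ_0, the claim fails. *)

theory Defs
  imports "HOL-Analysis.Analysis"
begin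

section \<open>Complex Banach spaces and unbounded operators\<close>

class complex_banach = banach +
  fixes scaleC :: "complex \<Rightarrow> 'a \<Rightarrow> 'a" (infixr \<open>*\<^sub>C\<close> 75)
  assumes scaleC_add_right: "a *\<^sub>C (x + y) = a *\<^sub>C x + a *\<^sub>C y"
    and scaleC_add_left: "(a + b) *\<^sub>C x = a *\<^sub>C x + b *\<^sub>C x"
    and scaleC_scaleC: "a *\<^sub>C (b *\<^sub>C x) = (a * b) *\<^sub>C x"
    and scaleC_of_real: "of_real r *\<^sub>C x = r *\<^sub>R x"
    and norm_scaleC: "norm (a *\<^sub>C x) = cmod a * norm x"

instantiation complex :: complex_banach
begin

definition scaleC_complex :: "complex \<Rightarrow> complex \<Rightarrow> complex" where
  "scaleC_complex a x = a * x"

instance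
  by standard (simp_all add: scaleC_complex_def algebra_simps scaleR_conv_of_real norm_mult)

end

definition clinear_on :: "'a::complex_banach set \<Rightarrow> ('a \<Rightarrow> 'a) \<Rightarrow> bool" where
  "clinear_on D T \<longleftrightarrow>
     0 \<in> D \<and>
     (\<forall>x\<in>D. \<forall>y\<in>D. x + y \<in> D \<and> T (x + y) = T x + T y) \<and>
     (\<forall>c. \<forall>x\<in>D. c *\<^sub>C x \<in> D \<and> T (c *\<^sub>C x) = c *\<^sub>C T x)"

text \<open>A possibly unbounded operator is a pair of its domain \<open>D\<close> and a total function \<open>T\<close>,
  of which only the values on \<open>D\<close> matter. The resolvent is \<open>R(\<lambda>,T) = (\<lambda> - T)\<^sup>-\<^sup>1\<close>.\<close>

definition resolvent :: "'a::complex_banach set \<Rightarrow> ('a \<Rightarrow> 'a) \<Rightarrow> complex \<Rightarrow> 'a \<Rightarrow> 'a" where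
  "resolvent D T z = inv_into D (\<lambda>x. z *\<^sub>C x - T x)"

definition resolvent_set :: "'a::complex_banach set \<Rightarrow> ('a \<Rightarrow> 'a) \<Rightarrow> complex set" where
  "resolvent_set D T =
     {z. bij_betw (\<lambda>x. z *\<^sub>C x - T x) D UNIV \<and> bounded_linear (resolvent D T z)}"

definition sector :: "real \<Rightarrow> complex set" where
  "sector \<theta> = {z. z \<noteq> 0 \<and> \<bar>Arg z\<bar> \<le> \<theta>}"

definition acquistapace_terreni ::
    "(real \<Rightarrow> 'a::complex_banach set) \<Rightarrow> (real \<Rightarrow> 'a \<Rightarrow> 'a) \<Rightarrow> bool" where
  "acquistapace_terreni D A \<longleftrightarrow>
     (\<forall>t\<ge>0. clinear_on (D t) (A t)) \<and>
     (\<exists>l0 \<theta> K1 K2 b1 b2 :: real.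
        l0 \<ge> 0 \<and> pi / 2 < \<theta> \<and> \<theta> < pi \<and> K1 \<ge> 0 \<and> K2 \<ge> 0 \<and>
        0 < b1 \<and> b1 \<le> 1 \<and> 0 < b2 \<and> b2 \<le> 1 \<and> b1 + b2 > 1 \<and>
        (\<forall>t\<ge>0. sector \<theta> \<union> {0} \<subseteq> resolvent_set (D t) (\<lambda>x. A t x - l0 *\<^sub>R x)) \<and>
        (\<forall>t\<ge>0. \<forall>z\<in>sector \<theta>.
           onorm (resolvent (D t) (\<lambda>x. A t x - l0 *\<^sub>R x) z) \<le> K1 / (1 + cmod z)) \<and>
        (\<forall>t\<ge>0. \<forall>s\<ge>0. \<forall>z\<in>sector \<theta>.
           onorm (\<lambda>x. let y = resolvent (D t) (\<lambda>x. A t x - l0 *\<^sub>R x) z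
                             (resolvent (D t) (A t) (of_real l0) x
                              - resolvent (D s) (A s) (of_real l0) x)
                      in A t y - l0 *\<^sub>R y)
             \<le> K2 * \<bar>t - s\<bar> powr b1 * cmod z powr (- b2)))"


section \<open>Evolution families\<close>

definition evolution_family :: "(real \<Rightarrow> real \<Rightarrow> 'a::complex_banach \<Rightarrow>\<^sub>L 'a) \<Rightarrow> bool" where
  "evolution_family U \<longleftrightarrow>
     (\<forall>t s. 0 \<le> s \<and> s \<le> t \<longrightarrow> clinear_on UNIV (blinfun_apply (U t s))) \<and>
     (\<forall>t\<ge>0. U t t = id_blinfun) \<and>
     (\<forall>t s r. 0 \<le> r \<and> r \<le> s \<and> s \<le> t \<longrightarrow> U t s o\<^sub>L U s r = U t r) \<and>
     (\<forall>x. continuous_on {(t, s). 0 \<le> s \<and> s \<le> t} (\<lambda>(t, s). blinfun_apply (U t s) x))"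

text \<open>\<open>U\<close> governs \<open>x'(t) = A(t) x(t)\<close>: for every \<open>s \<ge> 0\<close> and every initial value \<open>x\<close>, the map
  \<open>t \<mapsto> U(t,s)x\<close> is a classical solution on \<open>(s,\<infinity>)\<close>.\<close>

definition governed_by ::
    "(real \<Rightarrow> real \<Rightarrow> 'a::complex_banach \<Rightarrow>\<^sub>L 'a) \<Rightarrow> (real \<Rightarrow> 'a set) \<Rightarrow> (real \<Rightarrow> 'a \<Rightarrow> 'a) \<Rightarrow> bool" where
  "governed_by U D A \<longleftrightarrow>
     (\<forall>s\<ge>0. \<forall>t>s. \<forall>x. blinfun_apply (U t s) x \<in> D t \<and>
        ((\<lambda>\<tau>. blinfun_apply (U \<tau> s) x) has_vector_derivative A t (blinfun_apply (U t s) x)) (at t))"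


section \<open>Almost automorphic functions\<close>

definition AA :: "(real \<Rightarrow> 'a::real_normed_vector) set" where
  "AA = {f. continuous_on UNIV f \<and> bounded (range f) \<and>
     (\<forall>\<sigma>::nat \<Rightarrow> real. \<exists>r f'. strict_mono r \<and>
        (\<forall>t. (\<lambda>n. f (t + \<sigma> (r n))) \<longlonglongrightarrow> f' t \<and> (\<lambda>n. f' (t - \<sigma> (r n))) \<longlonglongrightarrow> f t))}"

definition AA_param :: "(real \<Rightarrow> 'b::real_normed_vector \<Rightarrow> 'a::real_normed_vector) set" where
  "AA_param = {f. continuous_on UNIV (\<lambda>(t, x). f t x) \<and> bounded (range (\<lambda>(t, x). f t x)) \<and>
     (\<forall>D (\<sigma>::nat \<Rightarrow> real). bounded D \<longrightarrow> (\<exists>r f'. strict_mono r \<and>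
        (\<forall>t. uniform_limit D (\<lambda>n. f (t + \<sigma> (r n))) (f' t) sequentially \<and>
             uniform_limit D (\<lambda>n. f' (t - \<sigma> (r n))) (f t) sequentially)))}"

definition C0 :: "(real \<Rightarrow> 'a::real_normed_vector) set" where
  "C0 = {\<phi>. continuous_on {0..} \<phi> \<and> (\<phi> \<longlongrightarrow> 0) at_top}"

definition C0_param :: "(real \<Rightarrow> 'b::real_normed_vector \<Rightarrow> 'a::real_normed_vector) set" where
  "C0_param = {\<phi>. continuous_on ({0..} \<times> UNIV) (\<lambda>(t, y). \<phi> t y) \<and>
     (\<forall>D. bounded D \<longrightarrow> uniform_limit D \<phi> (\<lambda>_. 0) at_top)}"

text \<open>A function on \<open>[0,\<infinity>)\<close> is a total function in \<open>extensional {0..}\<close>, so that equality of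
  elements of \<open>AAA\<close> is equality on \<open>[0,\<infinity>)\<close>; the zero function is \<open>\<lambda>t\<in>{0..}. 0\<close>.\<close>

definition AAA :: "(real \<Rightarrow> 'a::real_normed_vector) set" where
  "AAA = {g \<in> extensional {0..}. \<exists>f\<in>AA. \<exists>\<phi>\<in>C0. \<forall>t\<ge>0. g t = f t + \<phi> t}"

definition AAA_param :: "(real \<Rightarrow> 'b::real_normed_vector \<Rightarrow> 'a::real_normed_vector) set" where
  "AAA_param = {g. \<exists>f\<in>AA_param. \<exists>\<phi>\<in>C0_param. \<forall>t\<ge>0. \<forall>y. g t y = f t y + \<phi> t y}"

definition sup_norm :: "(real \<Rightarrow> 'a::real_normed_vector) \<Rightarrow> real" where
  "sup_norm u = (SUP t\<in>{0..}. norm (u t))"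


section \<open>Bi-almost automorphic and decomposable kernels\<close>

text \<open>\<open>S\<close> is a set of time pairs invariant under \<open>(t,s) \<mapsto> (t+\<tau>,s+\<tau>)\<close>, in practice the whole plane
  or the half plane \<open>t \<ge> s\<close>.\<close>

definition bi_aa_limit ::
    "(real \<times> real) set \<Rightarrow> 'b::real_normed_vector set \<Rightarrow> (real \<Rightarrow> real \<Rightarrow> 'b \<Rightarrow> 'a::real_normed_vector) \<Rightarrow>
     (nat \<Rightarrow> real) \<Rightarrow> (real \<Rightarrow> real \<Rightarrow> 'b \<Rightarrow> 'a) \<Rightarrow> bool" where
  "bi_aa_limit S D C \<sigma> C' \<longleftrightarrow>
     (\<forall>(t, s)\<in>S. uniform_limit D (\<lambda>n. C (t + \<sigma> n) (s + \<sigma> n)) (C' t s) sequentially \<and>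
                 uniform_limit D (\<lambda>n. C' (t - \<sigma> n) (s - \<sigma> n)) (C t s) sequentially)"

definition bi_almost_automorphic ::
    "(real \<times> real) set \<Rightarrow> (real \<Rightarrow> real \<Rightarrow> 'b::real_normed_vector \<Rightarrow> 'a::real_normed_vector) \<Rightarrow> bool" where
  "bi_almost_automorphic S C \<longleftrightarrow>
     continuous_on (S \<times> UNIV) (\<lambda>((t, s), x). C t s x) \<and>
     (\<forall>D (\<sigma>::nat \<Rightarrow> real). bounded D \<longrightarrow>
        (\<exists>r C'. strict_mono r \<and> bi_aa_limit S D C (\<sigma> \<circ> r) C'))"

text \<open>\<open>U(t,s)\<close> is given only for \<open>t \<ge> s \<ge> 0\<close>, while the definition evaluates at \<open>t \<plusminus> s\<^sub>n\<close> for
  arbitrary real \<open>s\<^sub>n\<close>; hence \<open>U\<close> is called Bi-almost automorphic if it is the restriction of a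
  function which is Bi-almost automorphic on the half plane \<open>t \<ge> s\<close> (as an asymptotically almost
  automorphic function on \<open>[0,\<infinity>)\<close> involves an almost automorphic function on the whole line).\<close>

definition bi_aa_evolution :: "(real \<Rightarrow> real \<Rightarrow> 'a::complex_banach \<Rightarrow>\<^sub>L 'a) \<Rightarrow> bool" where
  "bi_aa_evolution U \<longleftrightarrow>
     (\<exists>C. bi_almost_automorphic {(t, s). s \<le> t} C \<and>
          (\<forall>t s x. 0 \<le> s \<and> s \<le> t \<longrightarrow> C t s x = blinfun_apply (U t s) x))"

text \<open>The bounds \<open>\<lambda>\<^sub>1\<close>, \<open>\<nu>\<^sub>1\<close> and its counterpart for the limit functions, which are
  required uniformly on bounded subsets of the space, may depend on the bounded subset \<open>D\<close>.
  (A bound \<open>\<lambda>\<^sub>1\<close>, here \<open>l1\<close>, serving all of them at once would force a linear kernel to vanish.)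
  All finiteness and limit conditions on integrals include the existence of these integrals.\<close>

definition decomposable_kernel ::
    "(real \<Rightarrow> real \<Rightarrow> 'a::real_normed_vector \<Rightarrow> 'a) \<Rightarrow> bool" where
  "decomposable_kernel B0 \<longleftrightarrow>
     (\<exists>Ba B00 :: real \<Rightarrow> real \<Rightarrow> 'a \<Rightarrow> 'a.
        (\<forall>t s x. 0 \<le> s \<and> s \<le> t \<longrightarrow> B0 t s x = Ba t s x + B00 t s x) \<and>

        bi_almost_automorphic UNIV Ba \<and>
        (\<forall>D. bounded D \<longrightarrow> (\<exists>l1 :: real \<Rightarrow> real \<Rightarrow> real.
           (\<forall>t s. l1 t s > 0) \<and>
           (\<forall>t s \<tau>. \<forall>x\<in>D. norm (Ba (t + \<tau>) (s + \<tau>) x) \<le> l1 t s) \<and>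
           (\<forall>t. l1 t integrable_on {..t}) \<and>
           bdd_above (range (\<lambda>t. integral {..t} (l1 t))))) \<and>

        (\<exists>(\<theta>1 :: real \<Rightarrow> real \<Rightarrow> real) (Bh :: real \<Rightarrow> 'a \<Rightarrow> real).
           (\<forall>t. \<forall>s\<ge>0. \<theta>1 t s \<ge> 0) \<and>
           Bh \<in> C0_param \<and> (\<forall>s\<ge>0. \<forall>x. Bh s x \<ge> 0) \<and>
           (\<forall>t s x. 0 \<le> s \<and> s \<le> t \<longrightarrow> norm (B00 t s x) \<le> \<theta>1 t s * Bh s x) \<and>
           (\<forall>t\<ge>0. \<theta>1 t integrable_on {0..t}) \<and>
           (\<forall>T>0. ((\<lambda>t. integral {0..T} (\<theta>1 t)) \<longlongrightarrow> 0) at_top) \<and>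
           bdd_above ((\<lambda>t. integral {0..t} (\<theta>1 t)) ` {0..})) \<and>

        (\<forall>D. bounded D \<longrightarrow> (\<exists>\<nu>1 \<nu>1' :: real \<Rightarrow> real \<Rightarrow> real.
           (\<forall>t s. \<nu>1 t s \<ge> 0 \<and> \<nu>1' t s \<ge> 0) \<and>
           (\<forall>t s. \<forall>u\<in>D. \<forall>v\<in>D. norm (Ba t s u - Ba t s v) \<le> \<nu>1 t s * norm (u - v)) \<and>
           (\<forall>\<sigma> Ba'. bi_aa_limit UNIV D Ba \<sigma> Ba' \<longrightarrow>
              (\<forall>t s. \<forall>u\<in>D. \<forall>v\<in>D. norm (Ba' t s u - Ba' t s v) \<le> \<nu>1' t s * norm (u - v))) \<and>
           (\<forall>t\<ge>0. \<nu>1 t integrable_on {..t}) \<and>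
           bdd_above ((\<lambda>t. integral {..t} (\<nu>1 t)) ` {0..}) \<and>
           (\<forall>a b. a \<le> b \<longrightarrow> ((\<lambda>t. integral {a..b} (\<nu>1 t)) \<longlongrightarrow> 0) at_top))) \<and>

        (\<exists>vt :: real \<Rightarrow> real \<Rightarrow> real.
           (\<forall>t s. vt t s \<ge> 0) \<and>
           (\<forall>t s. norm (Ba t s 0) \<le> vt t s) \<and>
           (\<forall>\<^sub>F t in at_top. vt t integrable_on {..0}) \<and>
           ((\<lambda>t. integral {..0} (vt t)) \<longlongrightarrow> 0) at_top))"


section \<open>The nonlocal problem\<close>

text \<open>Vector-valued integrals are Henstock--Kurzweil integrals: the library's Bochner integral
  is confined to separable spaces.\<close>

definition kernel_op ::
    "(real \<Rightarrow> real \<Rightarrow> 'a::complex_banach \<Rightarrow>\<^sub>L 'a) \<Rightarrow> (real \<Rightarrow> 'a) \<Rightarrow> real \<Rightarrow> 'a" where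
  "kernel_op B u = (\<lambda>t\<in>{0..}. integral {0..t} (\<lambda>s. blinfun_apply (B t s) (u s)))"

definition kernel_const :: "(real \<Rightarrow> real \<Rightarrow> 'a::complex_banach \<Rightarrow>\<^sub>L 'a) \<Rightarrow> real" where
  "kernel_const B = (SUP s\<in>{0..}. integral {0..s} (\<lambda>\<tau>. norm (B s \<tau>)))"

definition base_fun ::
    "(real \<Rightarrow> real \<Rightarrow> 'a::complex_banach \<Rightarrow>\<^sub>L 'a) \<Rightarrow> (real \<Rightarrow> 'a \<times> 'a \<Rightarrow> 'a) \<Rightarrow>
     ((real \<Rightarrow> 'a) \<Rightarrow> 'a) \<Rightarrow> 'a \<Rightarrow> real \<Rightarrow> 'a" where
  "base_fun U F h u0 =
     (\<lambda>t\<in>{0..}. blinfun_apply (U t 0) (u0 + h (\<lambda>t\<in>{0..}. 0))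
                + integral {0..t} (\<lambda>s. blinfun_apply (U t s) (F s (0, 0))))"

definition Delta0 :: "(real \<Rightarrow> 'a::real_normed_vector) \<Rightarrow> real \<Rightarrow> (real \<Rightarrow> 'a) set" where
  "Delta0 y0 \<rho> = {y \<in> AAA. sup_norm (\<lambda>t. y t - y0 t) \<le> \<rho>}"

definition mild_solution ::
    "(real \<Rightarrow> real \<Rightarrow> 'a::complex_banach \<Rightarrow>\<^sub>L 'a) \<Rightarrow> (real \<Rightarrow> real \<Rightarrow> 'a \<Rightarrow>\<^sub>L 'a) \<Rightarrow>
     (real \<Rightarrow> 'a \<times> 'a \<Rightarrow> 'a) \<Rightarrow> ((real \<Rightarrow> 'a) \<Rightarrow> 'a) \<Rightarrow> 'a \<Rightarrow> (real \<Rightarrow> 'a) \<Rightarrow> bool" where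
  "mild_solution U B F h u0 u \<longleftrightarrow>
     continuous_on {0..} u \<and>
     (\<forall>t\<ge>0. (\<lambda>s. blinfun_apply (B t s) (u s)) integrable_on {0..t} \<and>
        (\<lambda>s. blinfun_apply (U t s) (F s (u s, kernel_op B u s))) integrable_on {0..t} \<and>
        u t = blinfun_apply (U t 0) (u0 + h u)
              + integral {0..t} (\<lambda>s. blinfun_apply (U t s) (F s (u s, kernel_op B u s))))"

end

(*
  The solution is the fixed point of u |-> U(t,0)(u0 + h u) + int_0^t U(t,s) F(s, u(s), Bu(s)) ds
  on Delta0. At time t the two terms are Lipschitz with constants exp(-delta t) M L_h and
  (1 - exp(-delta t)) M/delta (1 + C_B) L_F, so the map contracts with the maximum of M L_h and
  M/delta (1 + C_B) L_F, and the smallness condition makes Delta0 invariant because y0 is the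
  image of 0.

  For invariance of AAA, convolutions with bi-almost automorphic kernels are almost automorphic
  by scalar dominated convergence. Bu need not be continuous, hence need not belong to AAA, but
  it differs from an almost automorphic function by a function vanishing at infinity, and this
  survives composition with F; the convolution with U restores continuity.
*)

theory Submission
  imports Defs "HOL-Library.Diagonal_Subsequence"
begin

section \<open>Almost automorphic functions and uniform limits\<close>

text \<open>The Lipschitz bound for \<open>F\<close> concerns the sum \<open>f + \<phi>\<close>
  along functions of \<open>Delta0\<close> and their images under \<open>kernel_op B\<close>; it
  says nothing directly about the almost automorphic part \<open>f\<close>. Replacing an argument of
  \<open>f\<close> by its almost automorphic part is therefore justified by subsequences: among
  times tending to infinity, a further choice makes \<open>f\<close> converge uniformly on a ball
  while the argument converges. Limit functions of almost automorphic families are pointwise limits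
  in time without continuity, so vector integrals are compared only before the limit, and dominated
  convergence is applied to norms. Translation to infinity and back is used twice: it carries the
  decay of \<open>U\<close> to the negative times that convolution with an almost automorphic
  function requires, and it bounds the almost automorphic part of a function by the function on the
  half line, which makes \<open>AAA\<close> closed under uniform limits. Existence and uniqueness
  are both asserted within \<open>Delta0\<close>, the set on which \<open>h\<close> and
  \<open>F\<close> are controlled.\<close>

lemma LIMSEQ_subseq: "X \<longlonglongrightarrow> L \<Longrightarrow> strict_mono r \<Longrightarrow> (\<lambda>n. X (r n)) \<longlonglongrightarrow> L"
  for r :: "nat \<Rightarrow> nat"
  using LIMSEQ_subseq_LIMSEQ[of X L r] by (simp add: o_def)

text \<open>Splitting off \<open>g (x n)\<close> leaves uniform convergence on \<open>D\<close> and
  continuity of the limit \<open>g\<close>. This is how uniform convergence on balls becomes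
  convergence along moving arguments in the compositions below.\<close>

lemma uniform_limit_apply:
  fixes g :: "'b::topological_space \<Rightarrow> 'c::real_normed_vector"
  assumes "uniform_limit D f g F" "continuous_on D g" "(x \<longlongrightarrow> l) F" "\<And>n. x n \<in> D" "l \<in> D"
  shows "((\<lambda>n. f n (x n)) \<longlongrightarrow> g l) F"
proof (rule Lim_transform)
  show "((\<lambda>n. g (x n)) \<longlongrightarrow> g l) F"
    using assms by (intro continuous_on_tendsto_compose[of D g]) auto
  show "((\<lambda>n. f n (x n) - g (x n)) \<longlongrightarrow> 0) F"
  proof (rule tendstoI)
    fix e :: real assume "e > 0"
    then have "\<forall>\<^sub>F n in F. \<forall>y\<in>D. dist (f n y) (g y) < e"
      using assms(1) by (simp add: uniform_limit_iff)
    then show "\<forall>\<^sub>F n in F. dist (f n (x n) - g (x n)) 0 < e"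
      by eventually_elim (use assms(4) in \<open>auto simp: dist_norm\<close>)
  qed
qed

text \<open>The two limits in \<open>AA\<close> are separated from the choice of the subsequence, so
  that several functions can be followed along one common sequence of shifts.\<close>

definition aa_limit ::
    "(real \<Rightarrow> 'a::topological_space) \<Rightarrow> (nat \<Rightarrow> real) \<Rightarrow> (real \<Rightarrow> 'a) \<Rightarrow> bool" where
  "aa_limit f \<sigma> f' \<longleftrightarrow>
     (\<forall>t. (\<lambda>n. f (t + \<sigma> n)) \<longlonglongrightarrow> f' t \<and> (\<lambda>n. f' (t - \<sigma> n)) \<longlonglongrightarrow> f t)"

lemma aa_limit_subseq: "aa_limit f \<sigma> f' \<Longrightarrow> strict_mono r \<Longrightarrow> aa_limit f (\<sigma> \<circ> r) f'"
  unfolding aa_limit_def by (auto intro: LIMSEQ_subseq)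

text \<open>A diagonal sequence is a subsequence of the \<open>k\<close>-th chosen one only from
  some index on; this removes the offset.\<close>

lemma aa_limit_offset: "aa_limit f (\<sigma> \<circ> (+) k) f' \<longleftrightarrow> aa_limit f \<sigma> f'"
proof -
  have "(\<lambda>n. X (k + n)) \<longlonglongrightarrow> L \<longleftrightarrow> X \<longlonglongrightarrow> L" for X :: "nat \<Rightarrow> 'a" and L
    using LIMSEQ_ignore_initial_segment[of X L k] LIMSEQ_offset[of X k L]
    by (auto simp: add.commute)
  from this[of "\<lambda>n. f (_ + \<sigma> n)"] this[of "\<lambda>n. f' (_ - \<sigma> n)"] show ?thesis
    by (simp add: aa_limit_def)
qed

lemma AA_iff:
  "f \<in> AA \<longleftrightarrow> continuous_on UNIV f \<and> bounded (range f) \<and>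
     (\<forall>\<sigma> :: nat \<Rightarrow> real. \<exists>r f'. strict_mono r \<and> aa_limit f (\<sigma> \<circ> r) f')"
  by (simp add: AA_def aa_limit_def)

lemma AA_subseq: "f \<in> AA \<Longrightarrow> \<exists>r f'. strict_mono r \<and> aa_limit f (\<sigma> \<circ> r) f'"
  for \<sigma> :: "nat \<Rightarrow> real"
  unfolding AA_iff by blast

lemma AA_bound: "f \<in> AA \<Longrightarrow> \<exists>K>0. \<forall>t. norm (f t) \<le> K"
  by (auto simp: AA_iff bounded_pos)

lemma aa_limit_norm_bound:
  assumes "aa_limit f \<sigma> f'" "\<And>t. norm (f t) \<le> K"
  shows "norm (f' t) \<le> K"
  by (rule Lim_bounded[of "\<lambda>n. norm (f (t + \<sigma> n))" _ 0])
    (use assms in \<open>auto simp: aa_limit_def intro!: tendsto_norm\<close>)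

lemma AA_pair_limit:
  fixes \<sigma> :: "nat \<Rightarrow> real"
  assumes "f \<in> AA" "g \<in> AA"
  obtains r f' g' where "strict_mono r" "aa_limit f (\<sigma> \<circ> r) f'" "aa_limit g (\<sigma> \<circ> r) g'"
proof -
  obtain r1 f' where 1: "strict_mono r1" "aa_limit f (\<sigma> \<circ> r1) f'"
    using AA_subseq[OF assms(1), of \<sigma>] by blast
  obtain r2 g' where 2: "strict_mono r2" "aa_limit g (\<sigma> \<circ> r1 \<circ> r2) g'"
    using AA_subseq[OF assms(2), of "\<sigma> \<circ> r1"] by blast
  have "aa_limit f (\<sigma> \<circ> (r1 \<circ> r2)) f'"
    using aa_limit_subseq[OF 1(2) 2(1)] by (simp add: o_assoc)
  then show ?thesis
    using that[of "r1 \<circ> r2" f' g'] 1 2 by (simp add: strict_mono_o o_assoc)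
qed

lemma AA_Pair: "f \<in> AA \<Longrightarrow> g \<in> AA \<Longrightarrow> (\<lambda>t. (f t, g t)) \<in> AA"
  unfolding AA_iff[of "\<lambda>t. (f t, g t)"]
proof (intro conjI allI)
  assume fg: "f \<in> AA" "g \<in> AA"
  then show "continuous_on UNIV (\<lambda>t. (f t, g t))"
    by (auto simp: AA_iff intro!: continuous_intros)
  have "bounded (range f \<times> range g)"
    using fg by (auto simp: AA_iff intro: bounded_Times)
  then show "bounded (range (\<lambda>t. (f t, g t)))"
    by (rule bounded_subset) auto
  fix \<sigma> :: "nat \<Rightarrow> real"
  obtain r f' g' where "strict_mono r" "aa_limit f (\<sigma> \<circ> r) f'" "aa_limit g (\<sigma> \<circ> r) g'"
    using AA_pair_limit[OF fg] by blast
  then show "\<exists>r h. strict_mono r \<and> aa_limit (\<lambda>t. (f t, g t)) (\<sigma> \<circ> r) h"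
    by (intro exI[of _ r] exI[of _ "\<lambda>t. (f' t, g' t)"]) (auto simp: aa_limit_def intro!: tendsto_Pair)
qed

lemma AA_diff: "f \<in> AA \<Longrightarrow> g \<in> AA \<Longrightarrow> (\<lambda>t. f t - g t) \<in> AA"
  unfolding AA_iff[of "\<lambda>t. f t - g t"]
proof (intro conjI allI)
  assume fg: "f \<in> AA" "g \<in> AA"
  then show "continuous_on UNIV (\<lambda>t. f t - g t)"
    by (auto simp: AA_iff intro!: continuous_intros)
  show "bounded (range (\<lambda>t. f t - g t))"
    using fg by (auto simp: AA_iff intro: bounded_minus_comp)
  fix \<sigma> :: "nat \<Rightarrow> real"
  obtain r f' g' where "strict_mono r" "aa_limit f (\<sigma> \<circ> r) f'" "aa_limit g (\<sigma> \<circ> r) g'"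
    using AA_pair_limit[OF fg] by blast
  then show "\<exists>r h. strict_mono r \<and> aa_limit (\<lambda>t. f t - g t) (\<sigma> \<circ> r) h"
    by (intro exI[of _ r] exI[of _ "\<lambda>t. f' t - g' t"]) (auto simp: aa_limit_def intro!: tendsto_diff)
qed

lemma AA_const: "(\<lambda>_. c) \<in> AA"
  by (auto simp: AA_iff aa_limit_def intro!: exI[of _ id] strict_mono_id)

text \<open>Translating to infinity and back shows that an almost automorphic function is controlled
  by its behaviour at \<open>+\<infinity>\<close>.\<close>

lemma AA_norm_le:
  assumes f: "f \<in> AA" and \<phi>: "(\<phi> \<longlongrightarrow> 0) at_top" and c: "\<And>t. 0 \<le> t \<Longrightarrow> norm (f t + \<phi> t) \<le> c"
  shows "norm (f t) \<le> c"
proof -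
  obtain r f' where r: "strict_mono r" and f': "aa_limit f (real \<circ> r) f'"
    using AA_subseq[OF f, of real] by blast
  have top: "filterlim (\<lambda>n. s + real (r n)) at_top sequentially" for s
    using filterlim_compose[OF filterlim_real_sequentially filterlim_subseq[OF r]]
    by (intro filterlim_tendsto_add_at_top[OF tendsto_const]) (simp add: o_def)
  have "norm (f' s) \<le> c" for s
  proof (rule tendsto_upperbound)
    have "(\<lambda>n. f (s + real (r n)) + \<phi> (s + real (r n))) \<longlonglongrightarrow> f' s + 0"
      using f' by (intro tendsto_add filterlim_compose[OF \<phi> top]) (simp add: aa_limit_def)
    then show "(\<lambda>n. norm (f (s + real (r n)) + \<phi> (s + real (r n)))) \<longlonglongrightarrow> norm (f' s)"
      using tendsto_norm by fastforce
    show "\<forall>\<^sub>F n in sequentially. norm (f (s + real (r n)) + \<phi> (s + real (r n))) \<le> c"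
      using filterlim_at_top[THEN iffD1, OF top[of s], rule_format, of 0] by eventually_elim (rule c)
  qed simp
  moreover have "(\<lambda>n. f' (t - real (r n))) \<longlonglongrightarrow> f t"
    using f' by (simp add: aa_limit_def)
  ultimately show ?thesis
    by (intro Lim_bounded[OF tendsto_norm, of _ _ 0]) auto
qed

text \<open>A diagonal argument gives one sequence of shifts along which every \<open>f k\<close>
  has a limit function \<open>f' k\<close>. Distances between the \<open>f k\<close> pass to the
  \<open>f' k\<close>, which therefore converge uniformly, and both limits for \<open>g\<close>
  follow by interchanging limits.\<close>

lemma AA_uniform_limit:
  fixes g :: "real \<Rightarrow> 'a::banach"
  assumes f: "\<And>n. f n \<in> AA" and lim: "uniform_limit UNIV f g sequentially"
  shows "g \<in> AA"
  unfolding AA_iff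
proof (intro conjI allI)
  show "continuous_on UNIV g"
    using f by (intro uniform_limit_theorem[OF _ lim]) (auto simp: AA_iff)
  show "bounded (range g)"
    using f by (intro uniform_limit_bounded[OF lim]) (auto simp: AA_iff)
  fix \<sigma> :: "nat \<Rightarrow> real"
  interpret subseqs "\<lambda>k r. \<exists>f'. aa_limit (f k) (\<sigma> \<circ> r) f'"
  proof
    fix k and s :: "nat \<Rightarrow> nat" assume "strict_mono s"
    show "\<exists>r. strict_mono r \<and> (\<exists>f'. aa_limit (f k) (\<sigma> \<circ> (s \<circ> r)) f')"
      using AA_subseq[OF f[of k], of "\<sigma> \<circ> s"] unfolding o_assoc by blast
  qed
  define \<tau> where "\<tau> = \<sigma> \<circ> diagseq"
  have "\<exists>f'. aa_limit (f k) (\<sigma> \<circ> (diagseq \<circ> (+) (Suc k))) f'" for k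
  proof (rule diagseq_holds)
    fix r s :: "nat \<Rightarrow> nat" and k
    assume "strict_mono r" "\<exists>f'. aa_limit (f k) (\<sigma> \<circ> s) f'"
    then show "\<exists>f'. aa_limit (f k) (\<sigma> \<circ> (s \<circ> r)) f'"
      using aa_limit_subseq unfolding o_assoc by blast
  qed
  then have "\<exists>f'. aa_limit (f k) \<tau> f'" for k
    by (simp only: o_assoc aa_limit_offset \<tau>_def)
  then obtain f' where f': "\<And>k. aa_limit (f k) \<tau> (f' k)" by metis
  \<comment> \<open>\<open>N\<close> does not depend on \<open>t\<close>: it comes from closeness on
    the whole line, which the shifts \<open>\<tau> i\<close> leave intact. The limit in
    \<open>i\<close> preserves only the weak inequality.\<close>
  have close: "\<exists>N. \<forall>m\<ge>N. \<forall>n\<ge>N. \<forall>t. dist (f' m t) (f' n t) \<le> e" if "e > 0" for e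
  proof -
    obtain N where N: "\<forall>n\<ge>N. \<forall>t\<in>UNIV. dist (f n t) (g t) < e / 2"
      using lim \<open>e > 0\<close> unfolding uniform_limit_sequentially_iff by (meson half_gt_zero)
    have "dist (f' m t) (f' n t) \<le> e" if "m \<ge> N" "n \<ge> N" for m n t
    proof (rule Lim_bounded)
      show "(\<lambda>i. dist (f m (t + \<tau> i)) (f n (t + \<tau> i))) \<longlonglongrightarrow> dist (f' m t) (f' n t)"
        using f' by (intro tendsto_dist) (auto simp: aa_limit_def)
      have "dist (f m s) (f n s) \<le> e" for s
        using N[rule_format, of m s] N[rule_format, of n s] that dist_triangle2[of "f m s" "f n s" "g s"]
        by simp
      then show "\<forall>i\<ge>0. dist (f m (t + \<tau> i)) (f n (t + \<tau> i)) \<le> e" by simp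
    qed
    then show ?thesis by blast
  qed
  have "uniformly_Cauchy_on UNIV f'"
  proof (rule uniformly_Cauchy_onI)
    fix e :: real assume e: "e > 0"
    then obtain N where "\<forall>m\<ge>N. \<forall>n\<ge>N. \<forall>t. dist (f' m t) (f' n t) \<le> e / 2"
      using close[of "e / 2"] by auto
    moreover have "e / 2 < e" using e by simp
    ultimately show "\<exists>M. \<forall>x\<in>UNIV. \<forall>m\<ge>M. \<forall>n\<ge>M. dist (f' m x) (f' n x) < e"
      by (meson le_less_trans)
  qed
  then obtain g' where g': "uniform_limit UNIV f' g' sequentially"
    using Cauchy_uniformly_convergent unfolding uniformly_convergent_on_def by blast
  \<comment> \<open>Interchange of limits: convergence in \<open>k\<close> is uniform over the
    shifted times, convergence in \<open>n\<close> holds for each \<open>k\<close>.\<close>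
  have "(\<lambda>n. g (t + \<tau> n)) \<longlonglongrightarrow> g' t" for t
  proof (rule swap_uniform_limit'[where F = sequentially and f = "\<lambda>k n. f k (t + \<tau> n)" and g = "\<lambda>k. f' k t" and G = sequentially and l = "g' t" and S = UNIV])
    show "\<forall>\<^sub>F k in sequentially. (\<lambda>n. f k (t + \<tau> n)) \<longlonglongrightarrow> f' k t"
      using f' by (simp add: aa_limit_def)
    show "(\<lambda>k. f' k t) \<longlonglongrightarrow> g' t" by (rule tendsto_uniform_limitI[OF g']) simp
    show "uniform_limit UNIV (\<lambda>k n. f k (t + \<tau> n)) (\<lambda>n. g (t + \<tau> n)) sequentially"
      by (rule uniform_limit_compose'[OF lim]) simp
  qed simp_all
  moreover have "(\<lambda>n. g' (t - \<tau> n)) \<longlonglongrightarrow> g t" for t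
  proof (rule swap_uniform_limit'[where F = sequentially and f = "\<lambda>k n. f' k (t - \<tau> n)" and g = "\<lambda>k. f k t" and G = sequentially and l = "g t" and S = UNIV])
    show "\<forall>\<^sub>F k in sequentially. (\<lambda>n. f' k (t - \<tau> n)) \<longlonglongrightarrow> f k t"
      using f' by (simp add: aa_limit_def)
    show "(\<lambda>k. f k t) \<longlonglongrightarrow> g t" by (rule tendsto_uniform_limitI[OF lim]) simp
    show "uniform_limit UNIV (\<lambda>k n. f' k (t - \<tau> n)) (\<lambda>n. g' (t - \<tau> n)) sequentially"
      by (rule uniform_limit_compose'[OF g']) simp
  qed simp_all
  ultimately show "\<exists>r g'. strict_mono r \<and> aa_limit g (\<sigma> \<circ> r) g'"
    using subseq_diagseq unfolding \<tau>_def aa_limit_def by blast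
qed

section \<open>Functions vanishing at infinity and asymptotically almost automorphic
  functions\<close>

lemma C0_bound:
  assumes "\<phi> \<in> C0"
  shows "\<exists>K. \<forall>t\<ge>0. norm (\<phi> t) \<le> K"
proof -
  have cont: "continuous_on {0..} \<phi>" and "(\<phi> \<longlongrightarrow> 0) at_top"
    using assms by (auto simp: C0_def)
  then have "\<forall>\<^sub>F t in at_top. norm (\<phi> t) < 1"
    by (auto simp: tendsto_iff)
  then obtain T where T: "\<And>t. t \<ge> T \<Longrightarrow> norm (\<phi> t) < 1"
    by (auto simp: eventually_at_top_linorder)
  have "bounded (\<phi> ` {0..T})"
    by (intro compact_imp_bounded compact_continuous_image continuous_on_subset[OF cont]) auto
  then obtain K where K: "\<And>t. 0 \<le> t \<Longrightarrow> t \<le> T \<Longrightarrow> norm (\<phi> t) \<le> K"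
    unfolding bounded_iff by (metis atLeastAtMost_iff imageI)
  have "norm (\<phi> t) \<le> max K 1" if "t \<ge> 0" for t
    using K[OF that] T[of t] by (cases "t \<le> T") auto
  then show ?thesis by blast
qed

lemma AAA_bound: "u \<in> AAA \<Longrightarrow> \<exists>K>0. \<forall>t\<ge>0. norm (u t) \<le> K"
proof -
  assume "u \<in> AAA"
  then obtain f \<phi> where f: "f \<in> AA" and \<phi>: "\<phi> \<in> C0" and u: "\<And>t. t \<ge> 0 \<Longrightarrow> u t = f t + \<phi> t"
    by (auto simp: AAA_def)
  obtain K where "K > 0" "\<And>t. norm (f t) \<le> K" using AA_bound[OF f] by blast
  moreover obtain L where "\<And>t. t \<ge> 0 \<Longrightarrow> norm (\<phi> t) \<le> L" using C0_bound[OF \<phi>] by blast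
  ultimately have "\<forall>t\<ge>0. norm (u t) \<le> K + \<bar>L\<bar>"
    using u norm_triangle_le add_mono by (smt (verit, best))
  then show ?thesis using \<open>K > 0\<close> by (intro exI[of _ "K + \<bar>L\<bar>"]) simp
qed

lemma AAA_continuous: "u \<in> AAA \<Longrightarrow> continuous_on {0..} u"
proof -
  assume "u \<in> AAA"
  then obtain f \<phi> where "f \<in> AA" "\<phi> \<in> C0" and u: "\<And>t. t \<ge> 0 \<Longrightarrow> u t = f t + \<phi> t"
    by (auto simp: AAA_def)
  then have "continuous_on {0..} (\<lambda>t. f t + \<phi> t)"
    by (intro continuous_on_add) (auto simp: AA_iff C0_def intro: continuous_on_subset[of UNIV])
  then show ?thesis using u by (subst continuous_on_cong[OF refl]) auto
qed

text \<open>The decompositions are chosen separately for each \<open>n\<close>; their almost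
  automorphic parts still converge, because \<open>AA_norm_le\<close> bounds
  \<open>f m - f n\<close> on the whole line by the supremum of \<open>u m - u n\<close> on the half
  line. The remainders then converge as differences.\<close>

lemma AAA_uniform_limit:
  fixes u :: "nat \<Rightarrow> real \<Rightarrow> 'a::banach"
  assumes u: "\<And>n. u n \<in> AAA" and lim: "uniform_limit {0..} u v sequentially"
    and v: "v \<in> extensional {0..}"
  shows "v \<in> AAA"
proof -
  have "\<exists>f \<phi>. f \<in> AA \<and> \<phi> \<in> C0 \<and> (\<forall>t\<ge>0. u n t = f t + \<phi> t)" for n
    using u[of n] by (auto simp: AAA_def)
  then obtain f \<phi> where f: "\<And>n. f n \<in> AA" and \<phi>: "\<And>n. \<phi> n \<in> C0"
    and eq: "\<And>n t. t \<ge> 0 \<Longrightarrow> u n t = f n t + \<phi> n t"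
    by metis
  have Cauchy_f: "uniformly_Cauchy_on UNIV f"
  proof (rule uniformly_Cauchy_onI)
    fix e :: real assume "e > 0"
    then obtain N where N: "\<forall>n\<ge>N. \<forall>t\<in>{0..}. dist (u n t) (v t) < e / 4"
      using lim unfolding uniform_limit_sequentially_iff by (meson zero_less_divide_iff zero_less_numeral)
    have "norm (f m t - f n t) \<le> e / 2" if "m \<ge> N" "n \<ge> N" for m n t
    proof (rule AA_norm_le[OF AA_diff[OF f f], where \<phi> = "\<lambda>t. \<phi> m t - \<phi> n t"])
      show "((\<lambda>t. \<phi> m t - \<phi> n t) \<longlongrightarrow> 0) at_top"
        using tendsto_diff[of "\<phi> m" 0 at_top "\<phi> n" 0] \<phi> by (auto simp: C0_def)
      fix s :: real assume s: "0 \<le> s"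
      have "norm (u m s - u n s) \<le> e / 2"
        using N[rule_format, of m s] N[rule_format, of n s] that s
          dist_triangle2[of "u m s" "u n s" "v s"] by (simp add: dist_norm)
      then show "norm (f m s - f n s + (\<phi> m s - \<phi> n s)) \<le> e / 2"
        using s by (simp add: eq algebra_simps)
    qed
    then show "\<exists>M. \<forall>x\<in>UNIV. \<forall>m\<ge>M. \<forall>n\<ge>M. dist (f m x) (f n x) < e"
      using \<open>e > 0\<close> unfolding dist_norm by (intro exI[of _ N]) (smt (verit) field_sum_of_halves)
  qed
  then obtain g where g: "uniform_limit UNIV f g sequentially"
    using Cauchy_uniformly_convergent unfolding uniformly_convergent_on_def by blast
  have g_AA: "g \<in> AA" by (rule AA_uniform_limit[OF f g])
  define \<psi> where "\<psi> = (\<lambda>t. v t - g t)"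
  have "uniform_limit {0..} (\<lambda>n t. u n t - f n t) \<psi> sequentially"
    unfolding \<psi>_def by (intro uniform_limit_minus lim uniform_limit_on_subset[OF g]) simp
  then have lim\<phi>: "uniform_limit {0..} \<phi> \<psi> sequentially"
    by (subst (asm) uniform_limit_cong'[of _ _ \<phi> _ \<psi>]) (auto simp: eq)
  have "(\<psi> \<longlongrightarrow> 0) at_top"
  proof (rule swap_uniform_limit'[where F = sequentially and f = \<phi> and g = "\<lambda>_. 0" and G = at_top and l = 0 and S = "{0..}"])
    show "\<forall>\<^sub>F n in sequentially. (\<phi> n \<longlongrightarrow> 0) at_top"
      using \<phi> by (simp add: C0_def)
    show "\<forall>\<^sub>F t in at_top. t \<in> {0::real..}"
      using eventually_ge_at_top[of 0] by simp
  qed (use lim\<phi> in simp_all)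
  moreover have "continuous_on {0..} \<psi>"
    using \<phi> by (intro uniform_limit_theorem[OF _ lim\<phi>]) (auto simp: C0_def)
  ultimately have "\<psi> \<in> C0" by (simp add: C0_def)
  then have "\<exists>\<phi>\<in>C0. \<forall>t\<ge>0. v t = g t + \<phi> t"
    by (intro bexI[of _ \<psi>]) (simp_all add: \<psi>_def)
  then show ?thesis
    using v g_AA unfolding AAA_def by blast
qed

section \<open>Composition and integration\<close>

text \<open>The shifts are thinned for \<open>x\<close>, then for \<open>f\<close> on a ball
  containing the values of \<open>x\<close> and \<open>x'\<close>. The radius \<open>K + 1\<close>
  leaves room for the perturbed argument in \<open>AA_compose_perturb\<close>, and the intermediate
  limits are exported for the same purpose.\<close>

lemma AA_compose_limit:
  assumes f: "f \<in> AA_param" and x: "x \<in> AA" and K: "\<And>t. norm (x t) \<le> K"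
  fixes \<sigma> :: "nat \<Rightarrow> real"
  obtains r f' x' where "strict_mono r" "aa_limit x (\<sigma> \<circ> r) x'"
    "\<And>t. uniform_limit (cball 0 (K + 1)) (\<lambda>n. f (t + \<sigma> (r n))) (f' t) sequentially"
    "\<And>t. continuous_on (cball 0 (K + 1)) (f' t)"
    "aa_limit (\<lambda>t. f t (x t)) (\<sigma> \<circ> r) (\<lambda>t. f' t (x' t))"
proof -
  let ?D = "cball 0 (K + 1)"
  obtain r1 x' where r1: "strict_mono r1" and x'1: "aa_limit x (\<sigma> \<circ> r1) x'"
    using AA_subseq[OF x, of \<sigma>] by blast
  obtain r2 f' where r2: "strict_mono r2"
    and f'1: "\<And>t. uniform_limit ?D (\<lambda>n. f (t + (\<sigma> \<circ> r1) (r2 n))) (f' t) sequentially"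
    and f'2: "\<And>t. uniform_limit ?D (\<lambda>n. f' (t - (\<sigma> \<circ> r1) (r2 n))) (f t) sequentially"
    using f bounded_cball[of 0 "K + 1"] unfolding AA_param_def by fast
  let ?r = "r1 \<circ> r2"
  have x': "aa_limit x (\<sigma> \<circ> ?r) x'"
    using aa_limit_subseq[OF x'1 r2] by (simp add: o_assoc)
  have cont: "continuous_on ?D (f t)" for t
  proof -
    have "continuous_on UNIV (\<lambda>(t, y). f t y)" using f by (simp add: AA_param_def)
    from continuous_on_compose2[OF this, of ?D "\<lambda>y. (t, y)"] show ?thesis
      by (simp add: continuous_intros)
  qed
  have cont': "continuous_on ?D (f' t)" for t
    by (rule uniform_limit_theorem[OF _ f'1[of t]]) (auto intro!: always_eventually cont)
  have xD: "x t \<in> ?D" "x' t \<in> ?D" for t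
    using K[of t] aa_limit_norm_bound[OF x' K, of t] by auto
  have "(\<lambda>n. f (t + \<sigma> (r1 (r2 n))) (x (t + \<sigma> (r1 (r2 n))))) \<longlonglongrightarrow> f' t (x' t)" for t
    using x' xD by (intro uniform_limit_apply[OF f'1[of t] cont', unfolded comp_apply]) (auto simp: aa_limit_def)
  moreover have "(\<lambda>n. f' (t - \<sigma> (r1 (r2 n))) (x' (t - \<sigma> (r1 (r2 n))))) \<longlonglongrightarrow> f t (x t)" for t
    using x' xD by (intro uniform_limit_apply[OF f'2[of t] cont, unfolded comp_apply]) (auto simp: aa_limit_def)
  ultimately have "aa_limit (\<lambda>t. f t (x t)) (\<sigma> \<circ> ?r) (\<lambda>t. f' t (x' t))"
    by (simp add: aa_limit_def)
  then show ?thesis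
    using that[of ?r x' f'] r1 r2 x' f'1 cont' by (simp add: strict_mono_o)
qed

lemma AA_compose:
  assumes f: "f \<in> AA_param" and x: "x \<in> AA"
  shows "(\<lambda>t. f t (x t)) \<in> AA"
  unfolding AA_iff
proof (intro conjI allI)
  have "continuous_on UNIV (\<lambda>(t, y). f t y)" using f by (simp add: AA_param_def)
  moreover have "continuous_on UNIV (\<lambda>t. (t, x t))"
    using x by (auto simp: AA_iff intro!: continuous_intros)
  ultimately show "continuous_on UNIV (\<lambda>t. f t (x t))"
    using continuous_on_compose2[of UNIV "\<lambda>(t, y). f t y" UNIV "\<lambda>t. (t, x t)"] by simp
  have "bounded (range (\<lambda>(t, y). f t y))" using f by (simp add: AA_param_def)
  then show "bounded (range (\<lambda>t. f t (x t)))"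
    by (rule bounded_subset) auto
  fix \<sigma> :: "nat \<Rightarrow> real"
  obtain K where "\<And>t. norm (x t) \<le> K" using AA_bound[OF x] by blast
  then show "\<exists>r h. strict_mono r \<and> aa_limit (\<lambda>t. f t (x t)) (\<sigma> \<circ> r) h"
    by (rule AA_compose_limit[OF f x, of _ \<sigma>]) blast
qed

text \<open>No equicontinuity of \<open>f\<close> in the second variable is needed: along a subsequence of a putative
  bad sequence of times, \<open>f\<close> converges uniformly on bounded sets to a continuous function
  and \<open>x\<close> converges.\<close>

lemma AA_compose_perturb:
  assumes f: "f \<in> AA_param" and x: "x \<in> AA" and y: "((\<lambda>t. y t - x t) \<longlongrightarrow> 0) at_top"
  shows "((\<lambda>t. f t (y t) - f t (x t)) \<longlongrightarrow> 0) at_top"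
proof (rule ccontr)
  assume "\<not> ?thesis"
  then obtain e where e: "e > 0"
    and "\<not> (\<forall>\<^sub>F t in at_top. dist (f t (y t) - f t (x t)) 0 < e)"
    by (auto simp: tendsto_iff)
  then have "\<forall>n::nat. \<exists>t\<ge>real n. dist (f t (y t)) (f t (x t)) \<ge> e"
    unfolding eventually_at_top_linorder dist_norm diff_zero by (meson not_less)
  then obtain \<sigma> where \<sigma>: "\<And>n. \<sigma> n \<ge> real n" and bad: "\<And>n. dist (f (\<sigma> n) (y (\<sigma> n))) (f (\<sigma> n) (x (\<sigma> n))) \<ge> e"
    by metis
  obtain K where K: "\<And>t. norm (x t) \<le> K" using AA_bound[OF x] by blast
  let ?D = "cball 0 (K + 1)"
  obtain r f' x' where r: "strict_mono r" and x': "aa_limit x (\<sigma> \<circ> r) x'"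
    and f': "\<And>t. uniform_limit ?D (\<lambda>n. f (t + \<sigma> (r n))) (f' t) sequentially"
    and cont: "\<And>t. continuous_on ?D (f' t)"
    and lim: "aa_limit (\<lambda>t. f t (x t)) (\<sigma> \<circ> r) (\<lambda>t. f' t (x' t))"
    by (rule AA_compose_limit[OF f x K, of \<sigma>]) blast
  have top: "filterlim (\<lambda>n. \<sigma> (r n)) at_top sequentially"
  proof (rule filterlim_at_top_mono[OF filterlim_real_sequentially])
    have "real n \<le> \<sigma> (r n)" for n
      using \<sigma>[of "r n"] seq_suble[OF r, of n] by linarith
    then show "\<forall>\<^sub>F n in sequentially. real n \<le> \<sigma> (r n)" by simp
  qed
  let ?X = "\<lambda>n. x (\<sigma> (r n))" and ?Y = "\<lambda>n. y (\<sigma> (r n))"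
  have yx: "(\<lambda>n. ?Y n - ?X n) \<longlonglongrightarrow> 0"
    by (rule filterlim_compose[OF y top])
  have X: "?X \<longlonglongrightarrow> x' 0"
    using x'[unfolded aa_limit_def, rule_format, of 0] by simp
  have "norm (x' 0) \<le> K" by (rule aa_limit_norm_bound[OF x' K])
  from tendsto_add[OF yx X] have Y: "?Y \<longlonglongrightarrow> x' 0" by simp
  have "\<forall>\<^sub>F n in sequentially. dist (?Y n - ?X n) 0 < 1"
    using yx by (simp add: tendsto_iff)
  then have Y_in: "\<forall>\<^sub>F n in sequentially. ?Y n \<in> ?D"
  proof eventually_elim
    case (elim n)
    then show ?case using K[of "\<sigma> (r n)"] norm_triangle_sub[of "?Y n" "?X n"] by simp
  qed
  \<comment> \<open>\<open>uniform_limit_apply\<close> asks for arguments in the ball at every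
    index, whereas \<open>?Y n\<close> is there only eventually; the finitely many exceptions are
    replaced by the limit point.\<close>
  define Y' where "Y' n = (if ?Y n \<in> ?D then ?Y n else x' 0)" for n
  have Y'_eq: "\<forall>\<^sub>F n in sequentially. ?Y n = Y' n"
    using Y_in by eventually_elim (simp add: Y'_def)
  have Y': "Y' \<longlonglongrightarrow> x' 0" using tendsto_cong[OF Y'_eq] Y by blast
  \<comment> \<open>The bad times are read as shifts of the single time 0, so only the limits at
    \<open>t = 0\<close> enter.\<close>
  have "(\<lambda>n. f (0 + \<sigma> (r n)) (Y' n)) \<longlonglongrightarrow> f' 0 (x' 0)"
    using \<open>norm (x' 0) \<le> K\<close> by (intro uniform_limit_apply[OF f'[of 0] cont Y']) (auto simp: Y'_def)
  moreover have "\<forall>\<^sub>F n in sequentially. f (0 + \<sigma> (r n)) (Y' n) = f (\<sigma> (r n)) (?Y n)"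
    using Y'_eq by eventually_elim simp
  ultimately have "(\<lambda>n. f (\<sigma> (r n)) (?Y n)) \<longlonglongrightarrow> f' 0 (x' 0)"
    by (rule Lim_transform_eventually)
  moreover have "(\<lambda>n. f (\<sigma> (r n)) (?X n)) \<longlonglongrightarrow> f' 0 (x' 0)"
    using lim[unfolded aa_limit_def, rule_format, of 0] by simp
  ultimately have "(\<lambda>n. dist (f (\<sigma> (r n)) (?Y n)) (f (\<sigma> (r n)) (?X n))) \<longlonglongrightarrow> dist (f' 0 (x' 0)) (f' 0 (x' 0))"
    by (rule tendsto_dist)
  then have "e \<le> dist (f' 0 (x' 0)) (f' 0 (x' 0))"
    by (rule tendsto_lowerbound) (simp_all add: bad)
  with e show False by simp
qed

section \<open>Integrals depending on a time parameter\<close>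

text \<open>Scalar dominated convergence is applied to the norm of the difference. In this form it
  compares integrands that have no known integrable limit, as in the Cauchy argument of
  \<open>AA_integral\<close>.\<close>

lemma norm_integral_diff_tendsto_0:
  fixes p q :: "nat \<Rightarrow> real \<Rightarrow> 'a::banach"
  assumes p: "\<And>n. continuous_on {a..b} (p n)" and q: "\<And>n. continuous_on {a..b} (q n)"
    and m: "m integrable_on {a..b}"
    and le: "\<And>n s. s \<in> {a..b} \<Longrightarrow> norm (p n s) \<le> m s" "\<And>n s. s \<in> {a..b} \<Longrightarrow> norm (q n s) \<le> m s"
    and lim: "\<And>s. s \<in> {a..b} \<Longrightarrow> (\<lambda>n. p n s - q n s) \<longlonglongrightarrow> 0"
  shows "(\<lambda>n. integral {a..b} (p n) - integral {a..b} (q n)) \<longlonglongrightarrow> 0"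
proof (rule Lim_null_comparison)
  have int: "(\<lambda>s. norm (p n s - q n s)) integrable_on {a..b}" for n
    by (intro integrable_continuous_interval continuous_intros p q)
  show "\<forall>\<^sub>F n in sequentially.
      norm (integral {a..b} (p n) - integral {a..b} (q n)) \<le> integral {a..b} (\<lambda>s. norm (p n s - q n s))"
    by (auto simp: Henstock_Kurzweil_Integration.integral_diff[symmetric] integrable_continuous_interval p q
      intro!: always_eventually Henstock_Kurzweil_Integration.integral_norm_bound_integral int
        integrable_diff)
  have "(\<lambda>n. integral {a..b} (\<lambda>s. norm (p n s - q n s))) \<longlonglongrightarrow> integral {a..b} (\<lambda>_. 0 :: real)"
  proof (rule dominated_convergence(2)[where h = "\<lambda>s. 2 * m s"])
    fix n s assume s: "s \<in> {a..b}"
    show "norm (norm (p n s - q n s)) \<le> 2 * m s"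
      using le[OF s, of n] norm_triangle_ineq4[of "p n s" "q n s"] by simp
  next
    fix s assume "s \<in> {a..b}"
    from tendsto_norm_zero[OF lim[OF this]] show "(\<lambda>n. norm (p n s - q n s)) \<longlonglongrightarrow> 0" .
  qed (use int m integrable_on_cmult_left in auto)
  then show "(\<lambda>n. integral {a..b} (\<lambda>s. norm (p n s - q n s))) \<longlonglongrightarrow> 0" by simp
qed

text \<open>The limit function \<open>W'\<close> of the integrand is merely a pointwise limit of continuous
  functions, so its Banach-valued integral is avoided; only the scalar functions
  \<open>norm (W' _ \<rho> - W t \<rho>)\<close> are integrated.\<close>

lemma AA_integral:
  fixes W :: "real \<Rightarrow> real \<Rightarrow> 'a::banach"
  assumes cont: "continuous_on (UNIV \<times> {a..b}) (\<lambda>(t, \<rho>). W t \<rho>)"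
    and le: "\<And>t \<rho>. \<rho> \<in> {a..b} \<Longrightarrow> norm (W t \<rho>) \<le> m \<rho>" and m: "m integrable_on {a..b}"
    and lim: "\<And>\<sigma>::nat \<Rightarrow> real. \<exists>r W'. strict_mono r \<and>
                (\<forall>\<rho>\<in>{a..b}. aa_limit (\<lambda>t. W t \<rho>) (\<sigma> \<circ> r) (\<lambda>t. W' t \<rho>))"
  shows "(\<lambda>t. integral {a..b} (W t)) \<in> AA"
  unfolding AA_iff
proof (intro conjI allI)
  have contW: "continuous_on {a..b} (W t)" for t
    using continuous_on_compose2[OF cont, of "{a..b}" "\<lambda>\<rho>. (t, \<rho>)"] by (auto simp: continuous_intros)
  have intW: "W t integrable_on {a..b}" for t
    by (rule integrable_continuous_interval[OF contW])
  show "continuous_on UNIV (\<lambda>t. integral {a..b} (W t))"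
    using integral_continuous_on_param[of UNIV a b W] cont by simp
  have "norm (integral {a..b} (W t)) \<le> integral {a..b} m" for t
    by (rule Henstock_Kurzweil_Integration.integral_norm_bound_integral[OF intW m le])
  then show "bounded (range (\<lambda>t. integral {a..b} (W t)))"
    by (auto simp: bounded_iff)
  fix \<sigma> :: "nat \<Rightarrow> real"
  obtain r W' where r: "strict_mono r"
    and W'0: "\<And>\<rho>. \<rho> \<in> {a..b} \<Longrightarrow> aa_limit (\<lambda>t. W t \<rho>) (\<sigma> \<circ> r) (\<lambda>t. W' t \<rho>)"
    using lim[of \<sigma>] by blast
  define \<tau> where "\<tau> = \<sigma> \<circ> r"
  define J where "J t = integral {a..b} (W t)" for t
  have W': "(\<lambda>n. W (t + \<tau> n) \<rho>) \<longlonglongrightarrow> W' t \<rho>" "(\<lambda>n. W' (t - \<tau> n) \<rho>) \<longlonglongrightarrow> W t \<rho>"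
    if "\<rho> \<in> {a..b}" for t \<rho>
    using W'0[OF that] by (simp_all add: aa_limit_def \<tau>_def)
  have W'_le: "norm (W' t \<rho>) \<le> m \<rho>" if "\<rho> \<in> {a..b}" for t \<rho>
    by (rule Lim_bounded[OF tendsto_norm[OF W'(1)[OF that]], of 0]) (use le[OF that] in simp)
  \<comment> \<open>The limit of the integrals is obtained from completeness, not as an integral of
    \<open>W'\<close>: two index sequences violating the Cauchy condition would have integrands
    whose difference tends to 0 at each \<open>\<rho>\<close>.\<close>
  have "Cauchy (\<lambda>n. J (t + \<tau> n))" for t
  proof (rule ccontr)
    assume "\<not> ?thesis"
    then obtain e where e: "e > 0"
      and "\<forall>N::nat. \<exists>i\<ge>N. \<exists>j\<ge>N. dist (J (t + \<tau> i)) (J (t + \<tau> j)) \<ge> e"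
      unfolding Cauchy_def by (metis not_less)
    then obtain i j :: "nat \<Rightarrow> nat" where ij: "\<And>N. i N \<ge> N" "\<And>N. j N \<ge> N"
      and bad: "\<And>N. dist (J (t + \<tau> (i N))) (J (t + \<tau> (j N))) \<ge> e"
      by metis
    have top: "filterlim i at_top sequentially" "filterlim j at_top sequentially"
      using ij by (auto intro: filterlim_at_top_mono[OF filterlim_ident])
    have "(\<lambda>N. J (t + \<tau> (i N)) - J (t + \<tau> (j N))) \<longlonglongrightarrow> 0"
      unfolding J_def
    proof (rule norm_integral_diff_tendsto_0[OF contW contW m])
      fix \<rho> assume "\<rho> \<in> {a..b}"
      from tendsto_diff[OF filterlim_compose[OF W'(1)[OF this, of t] top(1)]
          filterlim_compose[OF W'(1)[OF this, of t] top(2)]]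
      show "(\<lambda>N. W (t + \<tau> (i N)) \<rho> - W (t + \<tau> (j N)) \<rho>) \<longlonglongrightarrow> 0" by simp
    qed (use le in auto)
    from tendsto_norm[OF this] have "e \<le> norm (0 :: 'a)"
      by (rule tendsto_lowerbound) (use bad in \<open>simp_all add: dist_norm\<close>)
    with e show False by simp
  qed
  then have "\<exists>l. (\<lambda>n. J (t + \<tau> n)) \<longlonglongrightarrow> l" for t
    using Cauchy_convergent_iff convergent_def by blast
  then obtain J' where J': "\<And>t. (\<lambda>n. J (t + \<tau> n)) \<longlonglongrightarrow> J' t" by metis
  have "(\<lambda>k. J' (t - \<tau> k)) \<longlonglongrightarrow> J t" for t
  proof (rule Lim_transform2[OF tendsto_const])
    \<comment> \<open>The scalar function \<open>?d k\<close> is integrable as a dominated pointwise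
      limit of continuous functions. Letting \<open>n\<close> grow with \<open>k\<close> fixed shows
      that its integral bounds the error at \<open>t - \<tau> k\<close>.\<close>
    let ?d = "\<lambda>k \<rho>. norm (W' (t - \<tau> k) \<rho> - W t \<rho>)"
    have dc: "?d k integrable_on {a..b} \<and>
        (\<lambda>n. integral {a..b} (\<lambda>\<rho>. norm (W (t - \<tau> k + \<tau> n) \<rho> - W t \<rho>))) \<longlonglongrightarrow> integral {a..b} (?d k)" for k
    proof (intro conjI; rule dominated_convergence[where h = "\<lambda>\<rho>. 2 * m \<rho>" and f = "\<lambda>n \<rho>. norm (W (t - \<tau> k + \<tau> n) \<rho> - W t \<rho>)"])
      fix n \<rho> assume s: "\<rho> \<in> {a..b}"
      show "norm (norm (W (t - \<tau> k + \<tau> n) \<rho> - W t \<rho>)) \<le> 2 * m \<rho>"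
        using le[OF s, of "t - \<tau> k + \<tau> n"] le[OF s, of t]
          norm_triangle_ineq4[of "W (t - \<tau> k + \<tau> n) \<rho>" "W t \<rho>"] by simp
      then show "norm (norm (W (t - \<tau> k + \<tau> n) \<rho> - W t \<rho>)) \<le> 2 * m \<rho>" .
    qed (use m integrable_on_cmult_left W'(1) in
        \<open>auto intro!: integrable_continuous_interval continuous_intros contW tendsto_intros\<close>)
    have le_d: "norm (J' (t - \<tau> k) - J t) \<le> integral {a..b} (?d k)" for k
    proof (rule LIMSEQ_le[OF tendsto_norm[OF tendsto_diff[OF J' tendsto_const]] conjunct2[OF dc]], intro exI allI impI)
      fix n
      show "norm (J (t - \<tau> k + \<tau> n) - J t) \<le> integral {a..b} (\<lambda>\<rho>. norm (W (t - \<tau> k + \<tau> n) \<rho> - W t \<rho>))"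
        unfolding J_def Henstock_Kurzweil_Integration.integral_diff[OF intW intW, symmetric]
        by (intro Henstock_Kurzweil_Integration.integral_norm_bound_integral integrable_diff intW)
          (auto intro!: integrable_continuous_interval continuous_intros contW)
    qed
    have "(\<lambda>k. integral {a..b} (?d k)) \<longlonglongrightarrow> integral {a..b} (\<lambda>_. 0 :: real)"
    proof (rule dominated_convergence(2)[where h = "\<lambda>\<rho>. 2 * m \<rho>"])
      fix k \<rho> assume s: "\<rho> \<in> {a..b}"
      show "norm (?d k \<rho>) \<le> 2 * m \<rho>"
        using W'_le[OF s, of "t - \<tau> k"] le[OF s, of t] norm_triangle_ineq4[of "W' (t - \<tau> k) \<rho>" "W t \<rho>"]
        by simp
    next
      fix \<rho> assume "\<rho> \<in> {a..b}"
      from W'(2)[OF this, of t] show "(\<lambda>k. ?d k \<rho>) \<longlonglongrightarrow> 0"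
        using LIM_zero tendsto_norm_zero by blast
    qed (use dc m integrable_on_cmult_left in auto)
    then have lim0: "(\<lambda>k. integral {a..b} (?d k)) \<longlonglongrightarrow> 0" by simp
    show "(\<lambda>k. J t - J' (t - \<tau> k)) \<longlonglongrightarrow> 0"
      by (rule Lim_null_comparison[OF always_eventually lim0]) (use le_d in \<open>simp add: norm_minus_commute\<close>)
  qed
  with J' r show "\<exists>r J'. strict_mono r \<and> aa_limit (\<lambda>t. integral {a..b} (W t)) (\<sigma> \<circ> r) J'"
    unfolding J_def \<tau>_def aa_limit_def by blast
qed

lemma integral_reflect_Icc:
  fixes f :: "real \<Rightarrow> 'a::banach"
  shows "integral {0..t} (\<lambda>\<rho>. f (t - \<rho>)) = integral {0..t} f"
proof -
  have "integral {0..t} (\<lambda>\<rho>. f (t - \<rho>)) = integral {- t..0} (f \<circ> (+) t)"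
    using Henstock_Kurzweil_Integration.integral_reflect_real[of 0 "- t" "f \<circ> (+) t"]
    by (simp add: o_def)
  also have "\<dots> = integral {0..t} f"
    by (subst integral_shift_Icc_real) simp
  finally show ?thesis .
qed

text \<open>\<open>a t\<close> stands for the integral of \<open>W t\<close> over the half line. It
  is the uniform limit of the \<open>A n\<close>, whose tails are bounded by those of
  \<open>m\<close> independently of \<open>t\<close>; the same bound controls what lies beyond the
  moving end point \<open>t\<close>.\<close>

lemma AA_improper_integral:
  fixes W :: "real \<Rightarrow> real \<Rightarrow> 'a::banach"
  assumes cont: "continuous_on (UNIV \<times> {0..}) (\<lambda>(t, \<rho>). W t \<rho>)"
    and le: "\<And>t \<rho>. 0 \<le> \<rho> \<Longrightarrow> norm (W t \<rho>) \<le> m \<rho>"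
    and m: "\<And>N. m integrable_on {0..N}" and bd: "\<And>N. 0 \<le> N \<Longrightarrow> integral {0..N} m \<le> K"
    and lim: "\<And>\<sigma>::nat \<Rightarrow> real. \<exists>r W'. strict_mono r \<and>
                (\<forall>\<rho>\<ge>0. aa_limit (\<lambda>t. W t \<rho>) (\<sigma> \<circ> r) (\<lambda>t. W' t \<rho>))"
  shows "\<exists>a\<in>AA. ((\<lambda>t. a t - integral {0..t} (W t)) \<longlongrightarrow> 0) at_top"
proof -
  define \<mu> where "\<mu> N = integral {0..N} m" for N
  define A where "A n t = integral {0..real n} (W t)" for n t
  have m_nonneg: "0 \<le> m \<rho>" if "0 \<le> \<rho>" for \<rho>
    by (rule order_trans[OF norm_ge_zero le[OF that]])
  have intW: "W t integrable_on {0..N}" for t N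
    using continuous_on_compose2[OF cont, of "{0..N}" "\<lambda>\<rho>. (t, \<rho>)"]
    by (intro integrable_continuous_interval) (force simp: continuous_intros)
  have tail: "norm (integral {0..N'} (W t) - integral {0..N} (W t)) \<le> \<mu> N' - \<mu> N"
    if "0 \<le> N" "N \<le> N'" for t N N'
  proof -
    have "integral {0..N'} (W t) - integral {0..N} (W t) = integral {N..N'} (W t)"
      using Henstock_Kurzweil_Integration.integral_combine[OF that intW] by (simp add: algebra_simps)
    moreover have "\<mu> N' - \<mu> N = integral {N..N'} m"
      using Henstock_Kurzweil_Integration.integral_combine[OF that m] by (simp add: \<mu>_def algebra_simps)
    moreover have "norm (integral {N..N'} (W t)) \<le> integral {N..N'} m"
      using that by (intro Henstock_Kurzweil_Integration.integral_norm_bound_integral le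
          integrable_subinterval_real[OF intW] integrable_subinterval_real[OF m]) auto
    ultimately show ?thesis by simp
  qed
  have mono: "\<mu> N \<le> \<mu> N'" if "0 \<le> N" "N \<le> N'" for N N'
    using tail[OF that] norm_ge_zero by (smt (verit))
  \<comment> \<open>\<open>L\<close> is the total mass of \<open>m\<close> on the half line;
    integers suffice in the supremum since \<open>\<mu>\<close> is monotone.\<close>
  define L where "L = (SUP n. \<mu> (real n))"
  have bdd: "bdd_above (range (\<lambda>n. \<mu> (real n)))"
    using bd by (auto simp: \<mu>_def intro!: bdd_aboveI[of _ K])
  have \<mu>_le: "\<mu> N \<le> L" if "0 \<le> N" for N
    using mono[OF that, of "real (nat \<lceil>N\<rceil>)"] cSUP_upper[OF _ bdd, of "nat \<lceil>N\<rceil>"] unfolding L_def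
    by (simp add: real_nat_ceiling_ge)
  have \<mu>_close: "\<exists>n. L - \<mu> (real n) < e" if "e > 0" for e
    using less_cSUP_iff[of UNIV "\<lambda>n. \<mu> (real n)" "L - e"] bdd that by (auto simp: L_def algebra_simps)
  have A_AA: "A n \<in> AA" for n
    unfolding A_def
  proof (rule AA_integral)
    show "continuous_on (UNIV \<times> {0..real n}) (\<lambda>(t, \<rho>). W t \<rho>)"
      by (rule continuous_on_subset[OF cont]) auto
    fix \<sigma> :: "nat \<Rightarrow> real"
    show "\<exists>r W'. strict_mono r \<and>
        (\<forall>\<rho>\<in>{0..real n}. aa_limit (\<lambda>t. W t \<rho>) (\<sigma> \<circ> r) (\<lambda>t. W' t \<rho>))"
      using lim[of \<sigma>] by (meson atLeastAtMost_iff)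
  qed (use le m in auto)
  have "uniformly_Cauchy_on UNIV A"
  proof (rule uniformly_Cauchy_onI')
    fix e :: real assume "e > 0"
    then obtain N where N: "L - \<mu> (real N) < e" using \<mu>_close by blast
    have "dist (A i t) (A j t) < e" if "i \<ge> N" "j > i" for i j t
      using tail[of "real i" "real j" t] \<mu>_le[of "real j"] mono[of "real N" "real i"] that N
      by (simp add: A_def dist_norm norm_minus_commute)
    then show "\<exists>M. \<forall>x\<in>UNIV. \<forall>m\<ge>M. \<forall>n>m. dist (A m x) (A n x) < e" by blast
  qed
  then obtain a where a: "uniform_limit UNIV A a sequentially"
    using Cauchy_uniformly_convergent unfolding uniformly_convergent_on_def by blast
  have close: "norm (a t - integral {0..t} (W t)) \<le> L - \<mu> t" if "0 \<le> t" for t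
  proof (rule tendsto_upperbound)
    show "(\<lambda>n. norm (A n t - integral {0..t} (W t))) \<longlonglongrightarrow> norm (a t - integral {0..t} (W t))"
      by (intro tendsto_norm tendsto_diff tendsto_uniform_limitI[OF a]) auto
    show "\<forall>\<^sub>F n in sequentially. norm (A n t - integral {0..t} (W t)) \<le> L - \<mu> t"
      using filterlim_at_top[THEN iffD1, OF filterlim_real_sequentially, rule_format, of t]
    proof eventually_elim
      case (elim n)
      show ?case
        using tail[OF that elim, of t] \<mu>_le[of "real n"] by (simp add: A_def)
    qed
  qed simp
  have "((\<lambda>t. a t - integral {0..t} (W t)) \<longlongrightarrow> 0) at_top"
  proof (rule tendstoI)
    fix e :: real assume "e > 0"
    then obtain N where N: "L - \<mu> (real N) < e" using \<mu>_close by blast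
    show "\<forall>\<^sub>F t in at_top. dist (a t - integral {0..t} (W t)) 0 < e"
      using eventually_ge_at_top[of "real N"]
    proof eventually_elim
      case (elim t)
      then show ?case
        using close[of t] mono[of "real N" t] N by simp
    qed
  qed
  with AA_uniform_limit[OF A_AA a] show ?thesis by blast
qed

section \<open>Convolutions with bi-almost automorphic kernels\<close>

text \<open>With \<open>\<rho>\<close> fixed, shifting \<open>t\<close> moves both time arguments of
  \<open>C\<close> and the argument of \<open>x\<close> by the same amount, so the limits along
  diagonal shifts apply. One subsequence serves all \<open>\<rho>\<close>, since
  \<open>bi_aa_limit\<close> covers all pairs of times at once.\<close>

lemma bi_aa_compose_limit:
  fixes \<sigma> :: "nat \<Rightarrow> real"
  assumes C: "bi_almost_automorphic {(t, s). s \<le> t} C" and x: "x \<in> AA"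
  shows "\<exists>r W'. strict_mono r \<and>
    (\<forall>\<rho>\<ge>0. aa_limit (\<lambda>t. C t (t - \<rho>) (x (t - \<rho>))) (\<sigma> \<circ> r) (\<lambda>t. W' t \<rho>))"
proof -
  obtain K where K: "\<And>t. norm (x t) \<le> K" using AA_bound[OF x] by blast
  let ?D = "cball 0 K"
  obtain r1 x' where r1: "strict_mono r1" and x'1: "aa_limit x (\<sigma> \<circ> r1) x'"
    using AA_subseq[OF x, of \<sigma>] by blast
  obtain r2 C' where r2: "strict_mono r2"
    and C': "bi_aa_limit {(t, s). s \<le> t} ?D C (\<sigma> \<circ> r1 \<circ> r2) C'"
    using C bounded_cball[of 0 K] unfolding bi_almost_automorphic_def by blast
  let ?\<tau> = "\<sigma> \<circ> r1 \<circ> r2"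
  have x': "aa_limit x ?\<tau> x'" by (rule aa_limit_subseq[OF x'1 r2])
  have xD: "x t \<in> ?D" "x' t \<in> ?D" for t
    using K[of t] aa_limit_norm_bound[OF x' K, of t] by auto
  have cont: "continuous_on ?D (C t s)" if "s \<le> t" for t s
  proof -
    have "continuous_on ({(t, s). s \<le> t} \<times> UNIV) (\<lambda>((t, s), x). C t s x)"
      using C by (simp add: bi_almost_automorphic_def)
    from continuous_on_compose2[OF this, of ?D "\<lambda>y. ((t, s), y)"] that show ?thesis
      by (auto simp: continuous_intros)
  qed
  have "aa_limit (\<lambda>t. C t (t - \<rho>) (x (t - \<rho>))) ?\<tau> (\<lambda>t. C' t (t - \<rho>) (x' (t - \<rho>)))"
    if \<rho>: "0 \<le> \<rho>" for \<rho>
    unfolding aa_limit_def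
  proof (intro allI conjI)
    fix t
    have lim1: "uniform_limit ?D (\<lambda>n. C (t + ?\<tau> n) (t - \<rho> + ?\<tau> n)) (C' t (t - \<rho>)) sequentially"
      and lim2: "uniform_limit ?D (\<lambda>n. C' (t - ?\<tau> n) (t - \<rho> - ?\<tau> n)) (C t (t - \<rho>)) sequentially"
      using C' \<rho> unfolding bi_aa_limit_def by auto
    have cont': "continuous_on ?D (C' t (t - \<rho>))"
      using \<rho> by (intro uniform_limit_theorem[OF _ lim1] always_eventually allI cont) auto
    have shift: "t + y - \<rho> = t - \<rho> + y" "t - y - \<rho> = t - \<rho> - y" for y
      by simp_all
    show "(\<lambda>n. C (t + ?\<tau> n) (t + ?\<tau> n - \<rho>) (x (t + ?\<tau> n - \<rho>))) \<longlonglongrightarrow> C' t (t - \<rho>) (x' (t - \<rho>))"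
      unfolding shift using x' xD unfolding aa_limit_def by (intro uniform_limit_apply[OF lim1 cont']) auto
    show "(\<lambda>n. C' (t - ?\<tau> n) (t - ?\<tau> n - \<rho>) (x' (t - ?\<tau> n - \<rho>))) \<longlonglongrightarrow> C t (t - \<rho>) (x (t - \<rho>))"
      unfolding shift using x' xD \<rho> unfolding aa_limit_def
      by (intro uniform_limit_apply[OF lim2 cont]) auto
  qed
  then show ?thesis
    using strict_mono_o[OF r1 r2]
    by (intro exI[of _ "r1 \<circ> r2"] exI[of _ "\<lambda>t \<rho>. C' t (t - \<rho>) (x' (t - \<rho>))"]) (simp add: o_assoc)
qed

lemma bi_aa_subset:
  assumes "bi_almost_automorphic T C" "S \<subseteq> T"
  shows "bi_almost_automorphic S C"
proof -
  have "continuous_on (S \<times> UNIV) (\<lambda>((t, s), x). C t s x)"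
    using assms unfolding bi_almost_automorphic_def by (blast intro: continuous_on_subset)
  moreover have "bi_aa_limit T D C \<sigma> C' \<Longrightarrow> bi_aa_limit S D C \<sigma> C'" for D \<sigma> C'
    using assms(2) by (auto simp: bi_aa_limit_def)
  ultimately show ?thesis
    using assms(1) unfolding bi_almost_automorphic_def by meson
qed

lemma bi_aa_continuous:
  assumes C: "bi_almost_automorphic {(t, s). s \<le> t} C"
    and "continuous_on X t" "continuous_on X s" "continuous_on X y" "\<And>z. z \<in> X \<Longrightarrow> s z \<le> t z"
  shows "continuous_on X (\<lambda>z. C (t z) (s z) (y z))"
proof -
  have "continuous_on ({(t, s). s \<le> t} \<times> UNIV) (\<lambda>((t, s), x). C t s x)"
    using C by (simp add: bi_almost_automorphic_def)
  from continuous_on_compose2[OF this, of X "\<lambda>z. ((t z, s z), y z)"] assms(2-) show ?thesis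
    by (auto simp: continuous_intros)
qed

text \<open>The substitution \<open>s = t - \<rho>\<close> allows a majorant \<open>m\<close> of the
  lag \<open>\<rho>\<close> alone, which is the form that \<open>AA_improper_integral\<close>
  handles.\<close>

lemma bi_aa_convolution:
  fixes C :: "real \<Rightarrow> real \<Rightarrow> 'b::real_normed_vector \<Rightarrow> 'a::banach"
  assumes C: "bi_almost_automorphic {(t, s). s \<le> t} C" and x: "x \<in> AA"
    and le: "\<And>t \<rho>. 0 \<le> \<rho> \<Longrightarrow> norm (C t (t - \<rho>) (x (t - \<rho>))) \<le> m \<rho>"
    and m: "\<And>N. m integrable_on {0..N}" and bd: "\<And>N. 0 \<le> N \<Longrightarrow> integral {0..N} m \<le> K"
  shows "\<exists>a\<in>AA. ((\<lambda>t. a t - integral {0..t} (\<lambda>s. C t s (x s))) \<longlongrightarrow> 0) at_top"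
proof -
  have "continuous_on UNIV x" using x by (simp add: AA_iff)
  then have "continuous_on (UNIV \<times> {0..}) (\<lambda>z. x (fst z - snd z))"
    by (rule continuous_on_compose2) (auto intro!: continuous_intros)
  then have "continuous_on (UNIV \<times> {0..}) (\<lambda>z. C (fst z) (fst z - snd z) (x (fst z - snd z)))"
    by (intro bi_aa_continuous[OF C] continuous_intros) auto
  then have "\<exists>a\<in>AA. ((\<lambda>t. a t - integral {0..t} (\<lambda>\<rho>. C t (t - \<rho>) (x (t - \<rho>)))) \<longlongrightarrow> 0) at_top"
    by (intro AA_improper_integral[OF _ le m bd] bi_aa_compose_limit[OF C x]) (simp_all add: case_prod_unfold)
  then show ?thesis
    using integral_reflect_Icc[of t "\<lambda>s. C t s (x s)" for t] by simp
qed

text \<open>The interval is cut at \<open>T\<close>: beyond \<open>T\<close> the factor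
  \<open>p\<close> is small while the mass of \<open>\<theta> t\<close> stays bounded; before
  \<open>T\<close> the mass fades while \<open>p\<close> is bounded. This serves the Lipschitz
  weight of the kernel, its vanishing part and the exponential weight of \<open>U\<close>
  alike.\<close>

lemma integral_tendsto_0_at_top:
  fixes f :: "real \<Rightarrow> real \<Rightarrow> 'a::banach"
  assumes f: "\<And>t. 0 \<le> t \<Longrightarrow> f t integrable_on {0..t}"
    and \<theta>: "\<And>t. 0 \<le> t \<Longrightarrow> \<theta> t integrable_on {0..t}"
    and nonneg: "\<And>t s. 0 \<le> s \<Longrightarrow> s \<le> t \<Longrightarrow> 0 \<le> \<theta> t s"
    and le: "\<And>t s. 0 \<le> s \<Longrightarrow> s \<le> t \<Longrightarrow> norm (f t s) \<le> \<theta> t s * p s"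
    and P: "\<And>s. 0 \<le> s \<Longrightarrow> p s \<le> P" and p: "(p \<longlongrightarrow> 0) at_top"
    and fade: "\<And>T. 0 < T \<Longrightarrow> ((\<lambda>t. integral {0..T} (\<theta> t)) \<longlongrightarrow> 0) at_top"
    and K: "\<And>t. 0 \<le> t \<Longrightarrow> integral {0..t} (\<theta> t) \<le> K"
  shows "((\<lambda>t. integral {0..t} (f t)) \<longlongrightarrow> 0) at_top"
proof (rule tendstoI)
  fix e :: real assume e: "e > 0"
  \<comment> \<open>The summand 1 here and in \<open>\<bar>P\<bar> + 1\<close> keeps the divisors
    positive.\<close>
  define k where "k = \<bar>K\<bar> + 1"
  have k: "k > 0" by (simp add: k_def)
  have "\<forall>\<^sub>F s in at_top. dist (p s) 0 < e / (2 * k)"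
    using p e k unfolding tendsto_iff by simp
  then obtain T0 where T0: "\<And>s. s \<ge> T0 \<Longrightarrow> p s \<le> e / (2 * k)"
    unfolding eventually_at_top_linorder by (metis abs_le_D1 diff_zero dist_real_def less_imp_le)
  define T where "T = max T0 1"
  have "\<forall>\<^sub>F t in at_top. dist (integral {0..T} (\<theta> t)) 0 < e / (2 * (\<bar>P\<bar> + 1))"
    using fade[of T] e unfolding tendsto_iff by (simp add: T_def)
  with eventually_ge_at_top[of T]
  show "\<forall>\<^sub>F t in at_top. dist (integral {0..t} (f t)) 0 < e"
  proof eventually_elim
    case (elim t)
    have T: "0 \<le> T" "T \<le> t" using elim by (simp_all add: T_def)
    have sub: "{0..T} \<subseteq> {0..t}" "{T..t} \<subseteq> {0..t}" using T by auto
    have \<theta>T: "\<theta> t integrable_on {0..T}" and \<theta>t: "\<theta> t integrable_on {T..t}"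
      using \<theta>[of t] T by (auto intro: integrable_subinterval_real)
    have "norm (integral {0..T} (f t)) \<le> integral {0..T} (\<lambda>s. \<theta> t s * (\<bar>P\<bar> + 1))"
    proof (rule Henstock_Kurzweil_Integration.integral_norm_bound_integral)
      fix s assume "s \<in> {0..T}"
      then have s: "0 \<le> s" "s \<le> t" using T by auto
      have "\<theta> t s * p s \<le> \<theta> t s * (\<bar>P\<bar> + 1)"
        using P[OF s(1)] by (intro mult_left_mono nonneg[OF s]) simp
      with le[OF s] show "norm (f t s) \<le> \<theta> t s * (\<bar>P\<bar> + 1)" by simp
    next
      show "f t integrable_on {0..T}"
        using f[of t] T sub by (auto intro: integrable_subinterval_real)
    qed (rule integrable_on_mult_left[OF \<theta>T])
    also have "\<dots> = integral {0..T} (\<theta> t) * (\<bar>P\<bar> + 1)" by simp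
    also have "\<dots> < e / 2"
    proof -
      have "integral {0..T} (\<theta> t) < e / (2 * (\<bar>P\<bar> + 1))" using elim by (auto simp: abs_less_iff)
      then show ?thesis by (simp add: pos_less_divide_eq field_simps)
    qed
    finally have 1: "norm (integral {0..T} (f t)) < e / 2" .
    have "norm (integral {T..t} (f t)) \<le> integral {T..t} (\<lambda>s. \<theta> t s * (e / (2 * k)))"
    proof (rule Henstock_Kurzweil_Integration.integral_norm_bound_integral)
      fix s assume "s \<in> {T..t}"
      then have s: "0 \<le> s" "s \<le> t" and "s \<ge> T0" using T by (auto simp: T_def)
      have "\<theta> t s * p s \<le> \<theta> t s * (e / (2 * k))"
        using T0[OF \<open>s \<ge> T0\<close>] by (intro mult_left_mono nonneg[OF s]) simp
      with le[OF s] show "norm (f t s) \<le> \<theta> t s * (e / (2 * k))" by simp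
    next
      show "f t integrable_on {T..t}"
        using f[of t] T sub by (auto intro: integrable_subinterval_real)
    qed (rule integrable_on_mult_left[OF \<theta>t])
    also have "\<dots> = integral {T..t} (\<theta> t) * (e / (2 * k))" by simp
    also have "\<dots> \<le> k * (e / (2 * k))"
    proof (rule mult_right_mono)
      have "integral {T..t} (\<theta> t) \<le> integral {0..t} (\<theta> t)"
        using T by (intro integral_subset_le \<theta>t \<theta>) (auto intro: nonneg)
      then show "integral {T..t} (\<theta> t) \<le> k" using K[of t] T by (simp add: k_def)
    qed (use e k in simp)
    also have "\<dots> = e / 2" using k by simp
    finally have 2: "norm (integral {T..t} (f t)) \<le> e / 2" .
    have "integral {0..t} (f t) = integral {0..T} (f t) + integral {T..t} (f t)"
      using Henstock_Kurzweil_Integration.integral_combine[OF T f] T by simp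
    then show ?case using 1 2 norm_triangle_ineq[of "integral {0..T} (f t)" "integral {T..t} (f t)"] by simp
  qed
qed

section \<open>Kernels and evolution families\<close>

text \<open>Uniformity over a ball makes every bounded \<open>y\<close> admissible, in particular
  the possibly discontinuous \<open>kernel_op B u\<close>.\<close>

lemma C0_param_tendsto:
  assumes "\<phi> \<in> C0_param" "\<And>s. 0 \<le> s \<Longrightarrow> norm (y s) \<le> K"
  shows "((\<lambda>s. \<phi> s (y s)) \<longlongrightarrow> 0) at_top"
proof (rule tendstoI)
  fix e :: real assume "e > 0"
  then have "\<forall>\<^sub>F s in at_top. \<forall>x\<in>cball 0 K. dist (\<phi> s x) 0 < e"
    using assms(1) bounded_cball unfolding C0_param_def uniform_limit_iff by blast
  with eventually_ge_at_top[of 0] show "\<forall>\<^sub>F s in at_top. dist (\<phi> s (y s)) 0 < e"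
    by eventually_elim (use assms(2) in auto)
qed

lemma C0_param_compose:
  assumes \<phi>: "\<phi> \<in> C0_param" and y: "continuous_on {0..} y" "\<And>s. 0 \<le> s \<Longrightarrow> norm (y s) \<le> K"
  shows "(\<lambda>s. \<phi> s (y s)) \<in> C0"
proof -
  have "continuous_on ({0..} \<times> UNIV) (\<lambda>(t, y). \<phi> t y)"
    using \<phi> by (simp add: C0_param_def)
  from continuous_on_compose2[OF this, of "{0..}" "\<lambda>s. (s, y s)"]
  have "continuous_on {0..} (\<lambda>s. \<phi> s (y s))"
    using y(1) by (force intro: continuous_on_Pair continuous_on_id)
  with C0_param_tendsto[OF \<phi> y(2)] show ?thesis by (simp add: C0_def)
qed

text \<open>The function approximated by \<open>a\<close> need not be continuous, so this is weaker
  than membership in \<open>AAA\<close>.\<close>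

lemma kernel_asymptotically_AA:
  fixes B :: "real \<Rightarrow> real \<Rightarrow> 'a::banach \<Rightarrow> 'a"
  assumes dec: "decomposable_kernel B" and u: "u \<in> AAA"
    and int: "\<And>t. 0 \<le> t \<Longrightarrow> (\<lambda>s. B t s (u s)) integrable_on {0..t}"
  shows "\<exists>a\<in>AA. ((\<lambda>t. integral {0..t} (\<lambda>s. B t s (u s)) - a t) \<longlongrightarrow> 0) at_top"
proof -
  obtain x \<psi> where x: "x \<in> AA" and \<psi>: "\<psi> \<in> C0" and u_eq: "\<And>t. t \<ge> 0 \<Longrightarrow> u t = x t + \<psi> t"
    using u by (auto simp: AAA_def)
  obtain Ku where Ku: "\<And>t. t \<ge> 0 \<Longrightarrow> norm (u t) \<le> Ku" using AAA_bound[OF u] by blast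
  obtain Kx where Kx: "\<And>t. norm (x t) \<le> Kx" using AA_bound[OF x] by blast
  \<comment> \<open>The bounds \<open>l1\<close> and \<open>\<nu>\<close> belong to one bounded set,
    so a single ball has to contain the values of \<open>u\<close> and those of its almost
    automorphic part \<open>x\<close>.\<close>
  define Q where "Q = cball (0 :: 'a) (max Ku Kx)"
  have Q: "bounded Q" "\<And>t. t \<ge> 0 \<Longrightarrow> u t \<in> Q" "\<And>t. x t \<in> Q"
    using Ku Kx by (auto simp: Q_def max.coboundedI1 max.coboundedI2)
  obtain Ba B00 :: "real \<Rightarrow> real \<Rightarrow> 'a \<Rightarrow> 'a" and \<theta> :: "real \<Rightarrow> real \<Rightarrow> real" and Bh :: "real \<Rightarrow> 'a \<Rightarrow> real"
    where split: "\<forall>t s x. 0 \<le> s \<and> s \<le> t \<longrightarrow> B t s x = Ba t s x + B00 t s x"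
      and Ba_UNIV: "bi_almost_automorphic UNIV Ba"
      and Ba_bd: "\<forall>D. bounded D \<longrightarrow> (\<exists>l1 :: real \<Rightarrow> real \<Rightarrow> real.
           (\<forall>t s. l1 t s > 0) \<and>
           (\<forall>t s \<tau>. \<forall>x\<in>D. norm (Ba (t + \<tau>) (s + \<tau>) x) \<le> l1 t s) \<and>
           (\<forall>t. l1 t integrable_on {..t}) \<and>
           bdd_above (range (\<lambda>t. integral {..t} (l1 t))))"
      and \<theta>_nonneg: "\<forall>t. \<forall>s\<ge>0. \<theta> t s \<ge> 0" and Bh: "Bh \<in> C0_param"
      and B00: "\<forall>t s x. 0 \<le> s \<and> s \<le> t \<longrightarrow> norm (B00 t s x) \<le> \<theta> t s * Bh s x"
      and \<theta>_int: "\<forall>t\<ge>0. \<theta> t integrable_on {0..t}"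
      and \<theta>_fade: "\<forall>T>0. ((\<lambda>t. integral {0..T} (\<theta> t)) \<longlongrightarrow> 0) at_top"
      and \<theta>_bdd: "bdd_above ((\<lambda>t. integral {0..t} (\<theta> t)) ` {0..})"
      and Ba_lip: "\<forall>D. bounded D \<longrightarrow> (\<exists>\<nu>1 \<nu>1' :: real \<Rightarrow> real \<Rightarrow> real.
           (\<forall>t s. \<nu>1 t s \<ge> 0 \<and> \<nu>1' t s \<ge> 0) \<and>
           (\<forall>t s. \<forall>u\<in>D. \<forall>v\<in>D. norm (Ba t s u - Ba t s v) \<le> \<nu>1 t s * norm (u - v)) \<and>
           (\<forall>\<sigma> Ba'. bi_aa_limit UNIV D Ba \<sigma> Ba' \<longrightarrow>
              (\<forall>t s. \<forall>u\<in>D. \<forall>v\<in>D. norm (Ba' t s u - Ba' t s v) \<le> \<nu>1' t s * norm (u - v))) \<and>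
           (\<forall>t\<ge>0. \<nu>1 t integrable_on {..t}) \<and>
           bdd_above ((\<lambda>t. integral {..t} (\<nu>1 t)) ` {0..}) \<and>
           (\<forall>a b. a \<le> b \<longrightarrow> ((\<lambda>t. integral {a..b} (\<nu>1 t)) \<longlongrightarrow> 0) at_top))"
    using dec unfolding decomposable_kernel_def by (elim exE conjE) (rule that; assumption)
  have Ba: "bi_almost_automorphic {(t, s). s \<le> t} Ba"
    by (rule bi_aa_subset[OF Ba_UNIV]) simp
  have Ba_cont: "continuous_on {0..t} (\<lambda>s. Ba t s (y s))" if "continuous_on {0..t} y" for t y
    using that by (intro bi_aa_continuous[OF Ba] continuous_intros) auto
  have cont_x: "continuous_on {0..t} x" for t
    using x by (auto simp: AA_iff intro: continuous_on_subset[of UNIV])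
  have cont_u: "continuous_on {0..t} u" for t
    using AAA_continuous[OF u] by (rule continuous_on_subset) auto
  have int_x: "(\<lambda>s. Ba t s (x s)) integrable_on {0..t}"
    and int_u: "(\<lambda>s. Ba t s (u s)) integrable_on {0..t}" for t
    using Ba_cont cont_x cont_u by (auto intro: integrable_continuous_interval)

  obtain l1 :: "real \<Rightarrow> real \<Rightarrow> real" where l1: "\<And>t s \<tau> x. x \<in> Q \<Longrightarrow> norm (Ba (t + \<tau>) (s + \<tau>) x) \<le> l1 t s"
      and l1_pos: "\<And>t s. l1 t s > 0" and l1_int: "\<And>t. l1 t integrable_on {..t}"
    using Ba_bd Q(1) by metis
  have "\<exists>a\<in>AA. ((\<lambda>t. a t - integral {0..t} (\<lambda>s. Ba t s (x s))) \<longlongrightarrow> 0) at_top"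
  proof (rule bi_aa_convolution[OF Ba x])
    fix t \<rho> :: real
    \<comment> \<open>Translating the pair \<open>(0, - \<rho>)\<close> by \<open>t\<close> yields
      \<open>(t, t - \<rho>)\<close>, so the majorant depends on the lag only.\<close>
    show "norm (Ba t (t - \<rho>) (x (t - \<rho>))) \<le> l1 0 (- \<rho>)"
      using l1[OF Q(3), of 0 t "- \<rho>"] by simp
  next
    fix N :: real
    have sub: "l1 0 integrable_on {- N..0}"
      using l1_int[of 0] by (rule integrable_on_subinterval) auto
    then show "(\<lambda>\<rho>. l1 0 (- \<rho>)) integrable_on {0..N}"
      using Henstock_Kurzweil_Integration.integrable_reflect_real[of "l1 0" 0 "- N"] by simp
    have "integral {0..N} (\<lambda>\<rho>. l1 0 (- \<rho>)) = integral {- N..0} (l1 0)"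
      using Henstock_Kurzweil_Integration.integral_reflect_real[of 0 "- N" "l1 0"] by simp
    also have "\<dots> \<le> integral {..0} (l1 0)"
      using l1_pos by (intro integral_subset_le sub l1_int) (auto intro: less_imp_le)
    finally show "integral {0..N} (\<lambda>\<rho>. l1 0 (- \<rho>)) \<le> integral {..0} (l1 0)" .
  qed
  then obtain a where a: "a \<in> AA"
    and lim_a: "((\<lambda>t. a t - integral {0..t} (\<lambda>s. Ba t s (x s))) \<longlongrightarrow> 0) at_top" by blast

  from Ba_lip[rule_format, OF Q(1)]
  obtain \<nu> :: "real \<Rightarrow> real \<Rightarrow> real" where \<nu>_Q: "\<forall>t s. \<forall>u\<in>Q. \<forall>v\<in>Q. norm (Ba t s u - Ba t s v) \<le> \<nu> t s * norm (u - v)"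
      and \<nu>_int: "\<forall>t\<ge>0. \<nu> t integrable_on {..t}"
      and \<nu>_bdd: "bdd_above ((\<lambda>t. integral {..t} (\<nu> t)) ` {0..})"
      and \<nu>_fade: "\<forall>a b. a \<le> b \<longrightarrow> ((\<lambda>t. integral {a..b} (\<nu> t)) \<longlongrightarrow> 0) at_top"
      and \<nu>_nonneg: "\<forall>t s. \<nu> t s \<ge> 0"
    by (elim exE conjE) (rule that, assumption, assumption, assumption, assumption, blast)
  have \<nu>: "norm (Ba t s v - Ba t s w) \<le> \<nu> t s * norm (v - w)" if "v \<in> Q" "w \<in> Q" for t s v w
    using \<nu>_Q that by blast
  have \<nu>_int0: "\<nu> t integrable_on {0..t}" if "t \<ge> 0" for t
    using \<nu>_int that by (intro integrable_on_subinterval[of _ "{..t}"]) auto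
  obtain K\<nu> where K\<nu>: "\<And>t. t \<ge> 0 \<Longrightarrow> integral {..t} (\<nu> t) \<le> K\<nu>"
    using \<nu>_bdd by (auto simp: bdd_above_def)
  obtain K\<psi> where K\<psi>: "\<And>t. t \<ge> 0 \<Longrightarrow> norm (\<psi> t) \<le> K\<psi>" using C0_bound[OF \<psi>] by blast
  \<comment> \<open>Passing from \<open>u\<close> to \<open>x\<close> costs the Lipschitz weight
    \<open>\<nu>\<close> times the norm of \<open>\<psi>\<close>, which tends to 0.\<close>
  have lim1: "((\<lambda>t. integral {0..t} (\<lambda>s. Ba t s (u s) - Ba t s (x s))) \<longlongrightarrow> 0) at_top"
  proof (rule integral_tendsto_0_at_top[where \<theta> = \<nu> and p = "\<lambda>s. norm (\<psi> s)" and P = K\<psi> and K = K\<nu>])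
    show "norm (Ba t s (u s) - Ba t s (x s)) \<le> \<nu> t s * norm (\<psi> s)" if "0 \<le> s" "s \<le> t" for t s
      using \<nu>[OF Q(2)[OF that(1)] Q(3)[of s], of t s] u_eq[OF that(1)] by simp
    show "((\<lambda>s. norm (\<psi> s)) \<longlongrightarrow> 0) at_top"
      using \<psi> by (auto simp: C0_def intro: tendsto_norm_zero)
    show "integral {0..t} (\<nu> t) \<le> K\<nu>" if "0 \<le> t" for t
    proof -
      have "integral {0..t} (\<nu> t) \<le> integral {..t} (\<nu> t)"
        using \<nu>_nonneg that by (intro integral_subset_le \<nu>_int[rule_format] \<nu>_int0) auto
      with K\<nu>[OF that] show ?thesis by simp
    qed
  qed (use \<nu>_nonneg \<nu>_int0 \<nu>_fade K\<psi> int_x int_u in \<open>auto intro: integrable_diff\<close>)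

  obtain K\<theta> where K\<theta>: "\<And>t. t \<ge> 0 \<Longrightarrow> integral {0..t} (\<theta> t) \<le> K\<theta>"
    using \<theta>_bdd by (auto simp: bdd_above_def)
  have Bh_u: "(\<lambda>s. Bh s (u s)) \<in> C0"
    by (rule C0_param_compose[OF Bh AAA_continuous[OF u] Ku])
  obtain K\<^sub>B where K\<^sub>B: "\<And>s. s \<ge> 0 \<Longrightarrow> norm (Bh s (u s)) \<le> K\<^sub>B" using C0_bound[OF Bh_u] by blast
  \<comment> \<open>The vanishing part is written as \<open>B - Ba\<close>, because integrability is
    known for these two terms but not for \<open>B00\<close> itself.\<close>
  have lim2: "((\<lambda>t. integral {0..t} (\<lambda>s. B t s (u s) - Ba t s (u s))) \<longlongrightarrow> 0) at_top"
  proof (rule integral_tendsto_0_at_top[where \<theta> = \<theta> and p = "\<lambda>s. Bh s (u s)" and P = K\<^sub>B and K = K\<theta>])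
    show "norm (B t s (u s) - Ba t s (u s)) \<le> \<theta> t s * Bh s (u s)" if "0 \<le> s" "s \<le> t" for t s
      using split B00 that by simp
    show "Bh s (u s) \<le> K\<^sub>B" if "0 \<le> s" for s
      using K\<^sub>B[OF that] by simp
    show "((\<lambda>s. Bh s (u s)) \<longlongrightarrow> 0) at_top" using Bh_u by (simp add: C0_def)
  qed (use \<theta>_nonneg \<theta>_int \<theta>_fade K\<theta> int int_u in \<open>auto intro: integrable_diff\<close>)

  have "((\<lambda>t. integral {0..t} (\<lambda>s. B t s (u s) - Ba t s (u s))
            + integral {0..t} (\<lambda>s. Ba t s (u s) - Ba t s (x s))
            - (a t - integral {0..t} (\<lambda>s. Ba t s (x s)))) \<longlongrightarrow> 0 + 0 - 0) at_top"
    by (intro tendsto_diff tendsto_add lim1 lim2 lim_a)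
  moreover have "\<forall>\<^sub>F t in at_top. integral {0..t} (\<lambda>s. B t s (u s) - Ba t s (u s))
            + integral {0..t} (\<lambda>s. Ba t s (u s) - Ba t s (x s))
            - (a t - integral {0..t} (\<lambda>s. Ba t s (x s))) = integral {0..t} (\<lambda>s. B t s (u s)) - a t"
    using eventually_ge_at_top[of 0]
    by eventually_elim (simp add: Henstock_Kurzweil_Integration.integral_diff int int_u int_x)
  ultimately have "((\<lambda>t. integral {0..t} (\<lambda>s. B t s (u s)) - a t) \<longlongrightarrow> 0) at_top"
    using Lim_transform_eventually by fastforce
  with a show ?thesis by blast
qed

section \<open>Evolution families with exponential decay\<close>

lemma has_integral_exp_decay:
  fixes \<delta> :: real
  assumes "\<delta> \<noteq> 0" "a \<le> b"
  shows "((\<lambda>s. exp (- \<delta> * (t - s))) has_integral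
           (exp (- \<delta> * (t - b)) - exp (- \<delta> * (t - a))) / \<delta>) {a..b}"
proof -
  have "((\<lambda>s. exp (- \<delta> * (t - s))) has_integral
      exp (- \<delta> * (t - b)) / \<delta> - exp (- \<delta> * (t - a)) / \<delta>) {a..b}"
    using assms by (intro fundamental_theorem_of_calculus)
      (auto intro!: derivative_eq_intros simp: has_real_derivative_iff_has_vector_derivative[symmetric])
  then show ?thesis by (simp add: diff_divide_distrib)
qed

lemma exp_decay_at_top: "\<delta> > 0 \<Longrightarrow> ((\<lambda>t. exp (- \<delta> * (t - T))) \<longlongrightarrow> 0) at_top"
  for \<delta> T :: real
proof (rule filterlim_compose[OF exp_at_bot])
  have "filterlim (\<lambda>t. - T + t) at_top at_top"
    by (rule filterlim_tendsto_add_at_top[OF tendsto_const filterlim_ident])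
  then show "filterlim (\<lambda>t. - \<delta> * (t - T)) at_bot at_top" if "\<delta> > 0"
    using that by (intro filterlim_tendsto_neg_mult_at_bot[OF tendsto_const]) (simp_all add: algebra_simps)
qed

text \<open>The decay of \<open>U\<close> is given only at nonnegative times. Shifting by integers
  to infinity brings every pair of times into that region; the limit function \<open>C'\<close>
  inherits the bound, which depends on \<open>t - s\<close> only, and shifting back returns it to
  \<open>C\<close>.\<close>

lemma bi_aa_evolution_extension:
  fixes U :: "real \<Rightarrow> real \<Rightarrow> 'a::complex_banach \<Rightarrow>\<^sub>L 'a"
  assumes "bi_aa_evolution U"
    and U_exp: "\<And>t s. 0 \<le> s \<Longrightarrow> s \<le> t \<Longrightarrow> norm (U t s) \<le> M * exp (- \<delta> * (t - s))"
  obtains C where "bi_almost_automorphic {(t, s). s \<le> t} C"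
    and "\<And>t s x. 0 \<le> s \<Longrightarrow> s \<le> t \<Longrightarrow> C t s x = blinfun_apply (U t s) x"
    and "\<And>t s x. s \<le> t \<Longrightarrow> norm (C t s x) \<le> M * exp (- \<delta> * (t - s)) * norm x"
proof -
  obtain C where C: "bi_almost_automorphic {(t, s). s \<le> t} C"
    and C_U: "\<And>t s x. 0 \<le> s \<Longrightarrow> s \<le> t \<Longrightarrow> C t s x = blinfun_apply (U t s) x"
    using assms(1) unfolding bi_aa_evolution_def by blast
  have "norm (C t s x) \<le> M * exp (- \<delta> * (t - s)) * norm x" if "s \<le> t" for t s x
  proof -
    obtain r C' where r: "strict_mono r"
      and lim: "bi_aa_limit {(t, s). s \<le> t} {x} C (real \<circ> r) C'"
      using C unfolding bi_almost_automorphic_def by (meson bounded_insert bounded_empty)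
    have lims: "(\<lambda>n. C (\<tau> + real (r n)) (\<sigma> + real (r n)) x) \<longlonglongrightarrow> C' \<tau> \<sigma> x"
        "(\<lambda>n. C' (\<tau> - real (r n)) (\<sigma> - real (r n)) x) \<longlonglongrightarrow> C \<tau> \<sigma> x" if "\<sigma> \<le> \<tau>" for \<tau> \<sigma>
      using lim that unfolding bi_aa_limit_def by (auto intro: tendsto_uniform_limitI)
    have "filterlim (\<lambda>n. real (r n)) at_top sequentially"
      using filterlim_compose[OF filterlim_real_sequentially filterlim_subseq[OF r]] .
    then have large: "\<forall>\<^sub>F n in sequentially. real (r n) \<ge> c" for c
      by (simp add: filterlim_at_top)
    have C'_le: "norm (C' \<tau> \<sigma> x) \<le> M * exp (- \<delta> * (\<tau> - \<sigma>)) * norm x" if "\<sigma> \<le> \<tau>" for \<tau> \<sigma>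
    proof (rule tendsto_upperbound[OF tendsto_norm[OF lims(1)[OF that]]])
      show "\<forall>\<^sub>F n in sequentially. norm (C (\<tau> + real (r n)) (\<sigma> + real (r n)) x)
          \<le> M * exp (- \<delta> * (\<tau> - \<sigma>)) * norm x"
        using large[of "- \<sigma>"]
      proof eventually_elim
        case (elim n)
        have "norm (C (\<tau> + real (r n)) (\<sigma> + real (r n)) x)
            \<le> norm (U (\<tau> + real (r n)) (\<sigma> + real (r n))) * norm x"
          using elim that by (simp add: C_U norm_blinfun)
        also have "\<dots> \<le> M * exp (- \<delta> * (\<tau> - \<sigma>)) * norm x"
          using U_exp[of "\<sigma> + real (r n)" "\<tau> + real (r n)"] elim that by (intro mult_right_mono) auto
        finally show ?case .
      qed
    qed simp
    have "norm (C' (t - real (r n)) (s - real (r n)) x) \<le> M * exp (- \<delta> * (t - s)) * norm x" for n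
      using C'_le[of "s - real (r n)" "t - real (r n)"] that by simp
    then show ?thesis
      by (intro Lim_bounded[OF tendsto_norm[OF lims(2)[OF that]], of 0]) simp
  qed
  with C C_U that show thesis by blast
qed

text \<open>Only \<open>U(t,s)G(s)\<close>, not \<open>G\<close> itself, is known to be integrable; continuity of the
  convolution is obtained by comparing it with \<open>t \<mapsto> U(t,r)I(r)\<close> for a fixed \<open>r\<close> close to \<open>t\<close>.\<close>

lemma evolution_convolution_continuous:
  fixes U :: "real \<Rightarrow> real \<Rightarrow> 'a::complex_banach \<Rightarrow>\<^sub>L 'a"
  assumes U: "evolution_family U"
    and int: "\<And>t. 0 \<le> t \<Longrightarrow> (\<lambda>s. blinfun_apply (U t s) (G s)) integrable_on {0..t}"
    and bd: "\<And>t s. 0 \<le> s \<Longrightarrow> s \<le> t \<Longrightarrow> norm (blinfun_apply (U t s) (G s)) \<le> K"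
  shows "continuous_on {0..} (\<lambda>t. integral {0..t} (\<lambda>s. blinfun_apply (U t s) (G s)))"
proof -
  define J where "J t = integral {0..t} (\<lambda>s. blinfun_apply (U t s) (G s))" for t
  have comp: "blinfun_apply (U t s) (blinfun_apply (U s r) x) = blinfun_apply (U t r) x"
    if "0 \<le> r" "r \<le> s" "s \<le> t" for t s r x
  proof -
    have "U t s o\<^sub>L U s r = U t r" using U that by (simp add: evolution_family_def)
    then show ?thesis by (metis blinfun_apply_blinfun_compose)
  qed
  \<comment> \<open>On \<open>[0, r]\<close> the bounded operator \<open>U t r\<close> factors out
    of the integral by the evolution law, so the difference is the integral over
    \<open>[r, t]\<close>.\<close>
  have J_near: "norm (J t - blinfun_apply (U t r) (J r)) \<le> K * (t - r)" if "0 \<le> r" "r \<le> t" for r t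
  proof -
    have "0 \<le> t" using that by simp
    have "J t = integral {0..r} (\<lambda>s. blinfun_apply (U t s) (G s))
        + integral {r..t} (\<lambda>s. blinfun_apply (U t s) (G s))"
      unfolding J_def using Henstock_Kurzweil_Integration.integral_combine[OF that int[OF \<open>0 \<le> t\<close>]] by simp
    also have "integral {0..r} (\<lambda>s. blinfun_apply (U t s) (G s))
        = integral {0..r} (\<lambda>s. blinfun_apply (U t r) (blinfun_apply (U r s) (G s)))"
      using that by (intro Henstock_Kurzweil_Integration.integral_cong) (simp add: comp)
    also have "\<dots> = blinfun_apply (U t r) (J r)"
      unfolding J_def using integral_linear[OF int[OF that(1)] blinfun.bounded_linear_right[of "U t r"]]
      by (simp add: o_def)
    finally have "J t - blinfun_apply (U t r) (J r) = integral {r..t} (\<lambda>s. blinfun_apply (U t s) (G s))"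
      by simp
    also have "norm \<dots> \<le> integral {r..t} (\<lambda>s. K)"
      using that by (intro Henstock_Kurzweil_Integration.integral_norm_bound_integral
          integrable_subinterval_real[OF int[OF \<open>0 \<le> t\<close>]] bd) auto
    finally show ?thesis using that by (simp add: mult.commute)
  qed
  have K: "0 \<le> K" using bd[of 0 0] norm_ge_zero by (metis order_refl order_trans)
  have "\<exists>d>0. \<forall>t'\<ge>0. \<bar>t' - t\<bar> < d \<longrightarrow> dist (J t') (J t) < e" if t: "0 \<le> t" and e: "e > 0" for t e
  proof -
    \<comment> \<open>For \<open>t'\<close> within \<open>\<eta>\<close> of \<open>t\<close>, the
      point \<open>r\<close> exceeds neither of them and has distance at most
      \<open>2 * \<eta>\<close> from \<open>t'\<close> and \<open>\<eta>\<close> from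
      \<open>t\<close>. The errors add up to at most \<open>3 * K * \<eta> + \<epsilon>\<close>,
      which stays within \<open>e\<close>; the summand 1 covers \<open>K = 0\<close>.\<close>
    define \<eta> where "\<eta> = e / (4 * (K + 1))"
    have \<eta>: "\<eta> > 0" "4 * K * \<eta> < e" using e K by (simp_all add: \<eta>_def field_simps)
    define r where "r = max 0 (t - \<eta>)"
    have r: "0 \<le> r" "r \<le> t" "t - r \<le> \<eta>" using t \<eta> by (auto simp: r_def)
    have "continuous_on {(t, s). 0 \<le> s \<and> s \<le> t} (\<lambda>(t, s). blinfun_apply (U t s) (J r))"
      using U by (simp add: evolution_family_def)
    from continuous_on_compose2[OF this, of "{r..}" "\<lambda>t. (t, r)"]
    have "continuous_on {r..} (\<lambda>t. blinfun_apply (U t r) (J r))"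
      using r by (force intro: continuous_on_Pair continuous_on_id continuous_on_const)
    moreover define \<epsilon> where "\<epsilon> = e - 4 * K * \<eta>"
    ultimately obtain d where d: "d > 0"
      and dU: "\<And>t'. t' \<ge> r \<Longrightarrow> dist t' t < d \<Longrightarrow>
        dist (blinfun_apply (U t' r) (J r)) (blinfun_apply (U t r) (J r)) < \<epsilon>"
      using r \<eta> unfolding continuous_on_iff \<epsilon>_def by (metis atLeast_iff diff_gt_0_iff_gt)
    have "dist (J t') (J t) < e" if t': "t' \<ge> 0" "\<bar>t' - t\<bar> < min d \<eta>" for t'
    proof -
      have rt': "r \<le> t'" "t' - r \<le> 2 * \<eta>" using t' r by (auto simp: r_def)
      have "norm (J t' - blinfun_apply (U t' r) (J r)) \<le> 2 * K * \<eta>"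
        using J_near[OF r(1) rt'(1)] mult_left_mono[OF rt'(2) K] by simp
      moreover have "norm (J t - blinfun_apply (U t r) (J r)) \<le> K * \<eta>"
        using J_near[OF r(1,2)] mult_left_mono[OF r(3) K] by simp
      moreover have "norm (blinfun_apply (U t' r) (J r) - blinfun_apply (U t r) (J r)) < \<epsilon>"
        using dU[OF rt'(1)] t' by (simp add: dist_norm)
      moreover have "J t' - J t = (J t' - blinfun_apply (U t' r) (J r))
          + (blinfun_apply (U t' r) (J r) - blinfun_apply (U t r) (J r)) - (J t - blinfun_apply (U t r) (J r))"
        by simp
      ultimately have "norm (J t' - J t) < 2 * K * \<eta> + \<epsilon> + K * \<eta>"
        by (smt (verit) norm_triangle_ineq norm_triangle_ineq4)
      then show ?thesis using K \<eta> by (simp add: dist_norm \<epsilon>_def) (smt (verit) mult_nonneg_nonneg)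
    qed
    then show ?thesis using d \<eta> by (intro exI[of _ "min d \<eta>"]) auto
  qed
  then show ?thesis
    unfolding J_def[symmetric] continuous_on_iff dist_real_def Ball_def atLeast_iff by blast
qed

text \<open>\<open>G\<close> is only asymptotic to \<open>g\<close> and may be discontinuous. The
  convolution of \<open>g\<close> supplies the almost automorphic part, the terms from
  \<open>G - g\<close> and from \<open>v\<close> vanish at infinity, and continuity of the remainder
  is inherited from the whole convolution.\<close>

lemma evolution_convolution_AAA:
  fixes U :: "real \<Rightarrow> real \<Rightarrow> 'a::complex_banach \<Rightarrow>\<^sub>L 'a"
  assumes U: "evolution_family U" and U_aa: "bi_aa_evolution U"
    and M: "M > 0" and \<delta>: "\<delta> > 0"
    and U_exp: "\<And>t s. 0 \<le> s \<Longrightarrow> s \<le> t \<Longrightarrow> norm (U t s) \<le> M * exp (- \<delta> * (t - s))"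
    and g: "g \<in> AA" and Gg: "((\<lambda>s. G s - g s) \<longlongrightarrow> 0) at_top"
    and G: "\<And>s. 0 \<le> s \<Longrightarrow> norm (G s) \<le> K"
    and int: "\<And>t. 0 \<le> t \<Longrightarrow> (\<lambda>s. blinfun_apply (U t s) (G s)) integrable_on {0..t}"
  shows "(\<lambda>t\<in>{0..}. blinfun_apply (U t 0) v + integral {0..t} (\<lambda>s. blinfun_apply (U t s) (G s))) \<in> AAA"
proof -
  define J where "J t = integral {0..t} (\<lambda>s. blinfun_apply (U t s) (G s))" for t
  obtain C where C: "bi_almost_automorphic {(t, s). s \<le> t} C"
    and C_U: "\<And>t s x. 0 \<le> s \<Longrightarrow> s \<le> t \<Longrightarrow> C t s x = blinfun_apply (U t s) x"
    and C_le: "\<And>t s x. s \<le> t \<Longrightarrow> norm (C t s x) \<le> M * exp (- \<delta> * (t - s)) * norm x"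
    using bi_aa_evolution_extension[OF U_aa U_exp] by blast
  have U_le: "norm (blinfun_apply (U t s) y) \<le> M * exp (- \<delta> * (t - s)) * norm y"
    if "0 \<le> s" "s \<le> t" for t s y
    using C_le[of s t y] that by (simp add: C_U)
  obtain Kg where Kg: "\<And>t. norm (g t) \<le> Kg" using AA_bound[OF g] by blast
  have Kg0: "0 \<le> Kg" using norm_ge_zero Kg[of 0] by (rule order_trans)

  have "\<exists>a\<in>AA. ((\<lambda>t. a t - integral {0..t} (\<lambda>s. C t s (g s))) \<longlongrightarrow> 0) at_top"
  proof (rule bi_aa_convolution[OF C g])
    fix t \<rho> :: real assume \<rho>: "0 \<le> \<rho>"
    have "norm (C t (t - \<rho>) (g (t - \<rho>))) \<le> M * exp (- \<delta> * \<rho>) * norm (g (t - \<rho>))"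
      using C_le[of "t - \<rho>" t] \<rho> by simp
    also have "\<dots> \<le> M * exp (- \<delta> * \<rho>) * Kg"
      using Kg M by (intro mult_left_mono) auto
    finally show "norm (C t (t - \<rho>) (g (t - \<rho>))) \<le> M * Kg * exp (- \<delta> * \<rho>)"
      by (simp add: mult_ac)
  next
    fix N :: real
    show int_m: "(\<lambda>\<rho>. M * Kg * exp (- \<delta> * \<rho>)) integrable_on {0..N}"
      by (intro integrable_continuous_interval continuous_intros)
    assume N: "0 \<le> N"
    have "integral {0..N} (\<lambda>\<rho>. exp (- \<delta> * \<rho>)) = integral {0..N} (\<lambda>s. exp (- \<delta> * (N - s)))"
      using integral_reflect_Icc[of N "\<lambda>\<rho>. exp (- \<delta> * \<rho>)"] by simp
    also have "\<dots> = (1 - exp (- \<delta> * N)) / \<delta>"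
      using has_integral_exp_decay[of \<delta> 0 N N] \<delta> N by (simp add: integral_unique)
    also have "\<dots> \<le> 1 / \<delta>" using \<delta> by (simp add: divide_right_mono)
    finally show "integral {0..N} (\<lambda>\<rho>. M * Kg * exp (- \<delta> * \<rho>)) \<le> M * Kg * (1 / \<delta>)"
      using M Kg0 by (simp only: Henstock_Kurzweil_Integration.integral_mult_right) (intro mult_left_mono, auto)
  qed
  then obtain a where a: "a \<in> AA"
    and lim_a: "((\<lambda>t. a t - integral {0..t} (\<lambda>s. C t s (g s))) \<longlongrightarrow> 0) at_top" by blast

  have g_cont: "continuous_on {0..t} g" for t
    using g by (auto simp: AA_iff intro: continuous_on_subset[of UNIV])
  have int_C: "(\<lambda>s. C t s (g s)) integrable_on {0..t}" for t
    by (intro integrable_continuous_interval bi_aa_continuous[OF C] g_cont continuous_intros) auto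
  have int_U: "(\<lambda>s. blinfun_apply (U t s) (g s)) integrable_on {0..t}" for t
    using int_C by (rule integrable_eq) (simp add: C_U)
  have eq_C: "integral {0..t} (\<lambda>s. C t s (g s)) = integral {0..t} (\<lambda>s. blinfun_apply (U t s) (g s))" for t
    by (intro Henstock_Kurzweil_Integration.integral_cong) (simp add: C_U)

  have lim_G: "((\<lambda>t. integral {0..t} (\<lambda>s. blinfun_apply (U t s) (G s) - blinfun_apply (U t s) (g s))) \<longlongrightarrow> 0) at_top"
  proof (rule integral_tendsto_0_at_top[where \<theta> = "\<lambda>t s. M * exp (- \<delta> * (t - s))"
        and p = "\<lambda>s. norm (G s - g s)" and P = "K + Kg" and K = "M * (1 / \<delta>)"])
    show "(\<lambda>s. blinfun_apply (U t s) (G s) - blinfun_apply (U t s) (g s)) integrable_on {0..t}" if "0 \<le> t" for t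
      by (intro integrable_diff int[OF that] int_U)
    show "norm (blinfun_apply (U t s) (G s) - blinfun_apply (U t s) (g s))
        \<le> M * exp (- \<delta> * (t - s)) * norm (G s - g s)" if "0 \<le> s" "s \<le> t" for t s
      using U_le[OF that, of "G s - g s"] by (simp add: blinfun.diff_right)
    show "norm (G s - g s) \<le> K + Kg" if "0 \<le> s" for s
      using norm_triangle_ineq4[of "G s" "g s"] G[OF that] Kg[of s] by simp
    show "((\<lambda>s. norm (G s - g s)) \<longlongrightarrow> 0) at_top" using Gg by (rule tendsto_norm_zero)
    fix T :: real assume T: "0 < T"
    have "((\<lambda>t. M * ((exp (- \<delta> * (t - T)) - exp (- \<delta> * (t - 0))) / \<delta>)) \<longlongrightarrow> M * ((0 - 0) / \<delta>)) at_top"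
      using \<delta> by (intro tendsto_intros exp_decay_at_top) auto
    moreover have "integral {0..T} (\<lambda>s. M * exp (- \<delta> * (t - s)))
        = M * ((exp (- \<delta> * (t - T)) - exp (- \<delta> * (t - 0))) / \<delta>)" for t
      using \<delta> T by (intro integral_unique has_integral_mult_right has_integral_exp_decay) auto
    ultimately show "((\<lambda>t. integral {0..T} (\<lambda>s. M * exp (- \<delta> * (t - s)))) \<longlongrightarrow> 0) at_top"
      by simp
  next
    fix t :: real assume "0 \<le> t"
    then have "integral {0..t} (\<lambda>s. exp (- \<delta> * (t - s))) \<le> 1 / \<delta>"
      using has_integral_exp_decay[of \<delta> 0 t t] \<delta> by (simp add: integral_unique divide_right_mono)
    then show "integral {0..t} (\<lambda>s. M * exp (- \<delta> * (t - s))) \<le> M * (1 / \<delta>)"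
      using M by (simp only: Henstock_Kurzweil_Integration.integral_mult_right) (intro mult_left_mono, auto)
    show "(\<lambda>s. M * exp (- \<delta> * (t - s))) integrable_on {0..t}"
      by (intro integrable_continuous_interval continuous_intros)
  qed (use M in auto)

  have lim_U0: "((\<lambda>t. blinfun_apply (U t 0) v) \<longlongrightarrow> 0) at_top"
  proof (rule Lim_null_comparison)
    show "\<forall>\<^sub>F t in at_top. norm (blinfun_apply (U t 0) v) \<le> M * exp (- \<delta> * (t - 0)) * norm v"
      using eventually_ge_at_top[of 0] by eventually_elim (rule U_le, auto)
    have "((\<lambda>t. M * exp (- \<delta> * (t - 0)) * norm v) \<longlongrightarrow> M * 0 * norm v) at_top"
      by (intro tendsto_intros exp_decay_at_top \<delta>)
    then show "((\<lambda>t. M * exp (- \<delta> * (t - 0)) * norm v) \<longlongrightarrow> 0) at_top" by simp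
  qed

  define \<phi> where "\<phi> t = blinfun_apply (U t 0) v + J t - a t" for t
  have "((\<lambda>t. blinfun_apply (U t 0) v
      + integral {0..t} (\<lambda>s. blinfun_apply (U t s) (G s) - blinfun_apply (U t s) (g s))
      - (a t - integral {0..t} (\<lambda>s. C t s (g s)))) \<longlongrightarrow> 0 + 0 - 0) at_top"
    by (intro tendsto_diff tendsto_add lim_a lim_G lim_U0)
  moreover have "\<forall>\<^sub>F t in at_top. blinfun_apply (U t 0) v
      + integral {0..t} (\<lambda>s. blinfun_apply (U t s) (G s) - blinfun_apply (U t s) (g s))
      - (a t - integral {0..t} (\<lambda>s. C t s (g s))) = \<phi> t"
    using eventually_ge_at_top[of 0]
    by eventually_elim (simp add: Henstock_Kurzweil_Integration.integral_diff int int_U eq_C \<phi>_def J_def)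
  ultimately have lim_\<phi>: "(\<phi> \<longlongrightarrow> 0) at_top"
    using Lim_transform_eventually by fastforce
  have "continuous_on {0..} J"
    unfolding J_def
  proof (rule evolution_convolution_continuous[OF U int])
    fix t s :: real assume s: "0 \<le> s" "s \<le> t"
    have "exp (- \<delta> * (t - s)) \<le> 1" using s \<delta> by simp
    then have "M * exp (- \<delta> * (t - s)) * norm (G s) \<le> M * 1 * K"
      using M G[OF s(1)] by (intro mult_mono) auto
    with U_le[OF s, of "G s"] show "norm (blinfun_apply (U t s) (G s)) \<le> M * 1 * K" by simp
  qed
  moreover have "continuous_on {0..} (\<lambda>t. blinfun_apply (U t 0) v)"
  proof -
    have "continuous_on {(t, s). 0 \<le> s \<and> s \<le> t} (\<lambda>(t, s). blinfun_apply (U t s) v)"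
      using U by (simp add: evolution_family_def)
    from continuous_on_compose2[OF this, of "{0..}" "\<lambda>t. (t, 0)"] show ?thesis
      by (force intro: continuous_on_Pair continuous_on_id continuous_on_const)
  qed
  moreover have "continuous_on {0..} a"
    using a by (auto simp: AA_iff intro: continuous_on_subset[of UNIV])
  ultimately have "\<phi> \<in> C0"
    using lim_\<phi> unfolding C0_def \<phi>_def by (auto intro!: continuous_intros)
  then have "\<exists>\<phi>\<in>C0. \<forall>t\<ge>0. blinfun_apply (U t 0) v + J t = a t + \<phi> t"
    by (intro bexI[of _ \<phi>]) (simp_all add: \<phi>_def)
  then show ?thesis
    using a unfolding AAA_def J_def[symmetric] by auto
qed

section \<open>Fixed points\<close>

lemma sup_norm_le: "(\<And>t. 0 \<le> t \<Longrightarrow> norm (u t) \<le> c) \<Longrightarrow> sup_norm u \<le> c"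
  unfolding sup_norm_def by (rule cSUP_least) auto

lemma norm_le_sup_norm:
  assumes "\<And>t. 0 \<le> t \<Longrightarrow> norm (u t) \<le> K" "0 \<le> t"
  shows "norm (u t) \<le> sup_norm u"
  unfolding sup_norm_def
  by (rule cSUP_upper) (use assms in \<open>auto intro!: bdd_aboveI[of _ K]\<close>)

lemma norm_diff_le_sup_norm:
  assumes "u \<in> AAA" "v \<in> AAA" "0 \<le> t"
  shows "norm (u t - v t) \<le> sup_norm (\<lambda>t. u t - v t)"
proof -
  obtain K L where "\<forall>t\<ge>0. norm (u t) \<le> K" "\<forall>t\<ge>0. norm (v t) \<le> L"
    using AAA_bound assms by metis
  then have "norm (u s - v s) \<le> K + L" if "0 \<le> s" for s
    using that norm_triangle_ineq4[of "u s" "v s"] by (smt (verit))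
  then show ?thesis using norm_le_sup_norm[of "\<lambda>t. u t - v t" "K + L" t] assms(3) by blast
qed

lemma AAA_zero: "(\<lambda>t\<in>{0..}. 0) \<in> AAA"
proof -
  have "(\<lambda>_. 0) \<in> C0" by (simp add: C0_def)
  then show ?thesis unfolding AAA_def using AA_const[of 0] by (auto intro!: bexI[of _ "\<lambda>_. 0"])
qed

text \<open>The contraction principle is applied in the complete space of bounded continuous
  functions on the whole line, where \<open>\<Delta>\<close> is embedded by constant extension to
  negative times; the distance there is the supremum over the half line.\<close>

lemma AAA_fixed_point:
  fixes \<Gamma> :: "(real \<Rightarrow> 'a::banach) \<Rightarrow> real \<Rightarrow> 'a"
  assumes \<Delta>: "\<Delta> \<subseteq> AAA" "\<Delta> \<noteq> {}"
    and closed: "\<And>u v. (\<And>n. u n \<in> \<Delta>) \<Longrightarrow> uniform_limit {0..} u v sequentially \<Longrightarrow>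
                   v \<in> extensional {0..} \<Longrightarrow> v \<in> \<Delta>"
    and maps: "\<And>u. u \<in> \<Delta> \<Longrightarrow> \<Gamma> u \<in> \<Delta>"
    and q: "0 \<le> q" "q < 1"
    and contr: "\<And>u v t. u \<in> \<Delta> \<Longrightarrow> v \<in> \<Delta> \<Longrightarrow> 0 \<le> t \<Longrightarrow>
                  norm (\<Gamma> u t - \<Gamma> v t) \<le> q * sup_norm (\<lambda>t. u t - v t)"
  shows "\<exists>!u. u \<in> \<Delta> \<and> \<Gamma> u = u"
proof -
  define E :: "(real \<Rightarrow> 'a) \<Rightarrow> real \<Rightarrow>\<^sub>C 'a" where "E u = Bcontfun (\<lambda>t. u (max 0 t))" for u
  define R :: "(real \<Rightarrow>\<^sub>C 'a) \<Rightarrow> real \<Rightarrow> 'a" where "R v = restrict (apply_bcontfun v) {0..}" for v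
  have E_apply: "apply_bcontfun (E u) t = u (max 0 t)" if u: "u \<in> \<Delta>" for u t
  proof -
    have uA: "u \<in> AAA" using u \<Delta> by blast
    have "continuous_on UNIV (\<lambda>t. u (max 0 t))"
      by (rule continuous_on_compose2[OF AAA_continuous[OF uA]]) (auto intro!: continuous_intros)
    moreover have "bounded (range (\<lambda>t. u (max 0 t)))"
      using AAA_bound[OF uA] unfolding bounded_iff by (metis imageE max.cobounded1)
    ultimately have "(\<lambda>t. u (max 0 t)) \<in> bcontfun" by (simp add: bcontfun_def)
    then show ?thesis by (simp add: E_def Bcontfun_inverse)
  qed
  have R_E: "R (E u) = u" if u: "u \<in> \<Delta>" for u
  proof -
    have "u \<in> extensional {0..}" using u \<Delta> by (auto simp: AAA_def)
    then show ?thesis by (auto simp: R_def E_apply[OF u] restrict_def extensional_def)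
  qed
  let ?S = "E ` \<Delta>"
  have "\<exists>!v\<in>?S. E (\<Gamma> (R v)) = v"
  proof (rule Banach_fix[OF _ _ q])
    show "complete ?S"
      unfolding complete_def
    proof (intro allI impI)
      fix \<sigma> assume \<sigma>: "(\<forall>n. \<sigma> n \<in> ?S) \<and> Cauchy \<sigma>"
      then obtain l where l: "\<sigma> \<longlonglongrightarrow> l" using Cauchy_convergent convergent_def by blast
      have R\<sigma>: "R (\<sigma> n) \<in> \<Delta>" "E (R (\<sigma> n)) = \<sigma> n" for n
        using \<sigma> R_E by (metis imageE)+
      have "uniform_limit UNIV (\<lambda>n. apply_bcontfun (\<sigma> n)) (apply_bcontfun l) sequentially"
      proof (rule uniform_limitI)
        fix e :: real assume "e > 0"
        with l have "\<forall>\<^sub>F n in sequentially. dist (\<sigma> n) l < e" by (simp add: tendsto_iff)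
        then show "\<forall>\<^sub>F n in sequentially. \<forall>x\<in>UNIV. dist (apply_bcontfun (\<sigma> n) x) (apply_bcontfun l x) < e"
          by eventually_elim (use dist_bounded in \<open>blast intro: le_less_trans\<close>)
      qed
      note ul = this
      have "uniform_limit {0..} (\<lambda>n. R (\<sigma> n)) (R l) sequentially"
        using uniform_limit_on_subset[OF ul, of "{0..}"]
        by (subst uniform_limit_cong'[where g = "\<lambda>n. apply_bcontfun (\<sigma> n)" and i = "apply_bcontfun l"])
          (auto simp: R_def)
      then have Rl: "R l \<in> \<Delta>"
        by (rule closed[OF R\<sigma>(1)]) (simp add: R_def)
      \<comment> \<open>The limit lies in the image only if it is constant on negative times, a
        property that it inherits from the \<open>\<sigma> n\<close>.\<close>
      have "apply_bcontfun (E (R l)) t = apply_bcontfun l t" for t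
      proof -
        have lim: "(\<lambda>n. apply_bcontfun (\<sigma> n) t) \<longlonglongrightarrow> apply_bcontfun l t" for t
          by (rule tendsto_uniform_limitI[OF ul]) simp
        have "apply_bcontfun (\<sigma> n) t = apply_bcontfun (\<sigma> n) (max 0 t)" for n
          using E_apply[OF R\<sigma>(1)[of n], of t] E_apply[OF R\<sigma>(1)[of n], of "max 0 t"] R\<sigma>(2)[of n] by simp
        then have "apply_bcontfun l t = apply_bcontfun l (max 0 t)"
          using lim[of t] lim[of "max 0 t"] LIMSEQ_unique by auto
        then show ?thesis unfolding E_apply[OF Rl] by (simp add: R_def)
      qed
      then have "E (R l) = l" by (intro bcontfun_eqI)
      with Rl l show "\<exists>l\<in>?S. \<sigma> \<longlonglongrightarrow> l" by (metis imageI)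
    qed
    show "?S \<noteq> {}" using \<Delta> by simp
    show "(\<lambda>v. E (\<Gamma> (R v))) ` ?S \<subseteq> ?S" using maps R_E by auto
    fix v w assume "v \<in> ?S" "w \<in> ?S"
    then obtain x y where x: "x \<in> \<Delta>" "v = E x" and y: "y \<in> \<Delta>" "w = E y" by blast
    have "sup_norm (\<lambda>t. x t - y t) \<le> dist v w"
    proof (rule sup_norm_le)
      fix t :: real assume "0 \<le> t"
      then show "norm (x t - y t) \<le> dist v w"
        using dist_bounded[of v t w] x y by (simp add: E_apply dist_norm)
    qed
    then have "q * sup_norm (\<lambda>t. x t - y t) \<le> q * dist v w"
      using q by (intro mult_left_mono)
    moreover have "dist (E (\<Gamma> x)) (E (\<Gamma> y)) \<le> q * sup_norm (\<lambda>t. x t - y t)"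
      by (rule dist_bound) (simp add: E_apply maps x y dist_norm contr)
    ultimately show "dist (E (\<Gamma> (R v))) (E (\<Gamma> (R w))) \<le> q * dist v w"
      by (simp add: x y R_E)
  qed
  then obtain v where v: "v \<in> ?S" "E (\<Gamma> (R v)) = v"
    and uniq: "\<And>w. w \<in> ?S \<Longrightarrow> E (\<Gamma> (R w)) = w \<Longrightarrow> w = v" by blast
  then obtain u where u: "u \<in> \<Delta>" "v = E u" by blast
  show ?thesis
  proof (rule ex1I[of _ u])
    show "u \<in> \<Delta> \<and> \<Gamma> u = u"
      using u v R_E maps by metis
    fix w assume w: "w \<in> \<Delta> \<and> \<Gamma> w = w"
    then have "E w = v" using uniq[of "E w"] by (simp add: R_E)
    then show "w = u" using w u R_E by metis
  qed
qed

section \<open>The contraction on \<open>Delta0\<close> and its fixed point\<close>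

theorem theorem5p6:
  fixes D :: "real \<Rightarrow> 'a::complex_banach set"
    and A :: "real \<Rightarrow> 'a \<Rightarrow> 'a"
    and U B :: "real \<Rightarrow> real \<Rightarrow> 'a \<Rightarrow>\<^sub>L 'a"
    and F :: "real \<Rightarrow> 'a \<times> 'a \<Rightarrow> 'a"
    and h :: "(real \<Rightarrow> 'a) \<Rightarrow> 'a"
    and u0 :: 'a
    and M \<delta> \<rho> L\<^sub>F L\<^sub>h :: real
    and y0 :: "real \<Rightarrow> 'a"
  assumes AT: "acquistapace_terreni D A"
    and U_evol: "evolution_family U"
    and U_gov: "governed_by U D A"
    and U_bi_aa: "bi_aa_evolution U"
    and M_pos: "M > 0" and \<delta>_pos: "\<delta> > 0"
    and U_exp: "\<And>t s. 0 \<le> s \<Longrightarrow> s \<le> t \<Longrightarrow> norm (U t s) \<le> M * exp (- \<delta> * (t - s))"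
    and B_linear: "\<And>t s. 0 \<le> s \<Longrightarrow> s \<le> t \<Longrightarrow> clinear_on UNIV (blinfun_apply (B t s))"
    and B_decomp: "decomposable_kernel (\<lambda>t s. blinfun_apply (B t s))"
    and B_norm_int: "\<And>s. 0 \<le> s \<Longrightarrow> (\<lambda>\<tau>. norm (B s \<tau>)) integrable_on {0..s}"
    and B_const: "bdd_above ((\<lambda>s. integral {0..s} (\<lambda>\<tau>. norm (B s \<tau>))) ` {0..})"
    and F_AAA: "F \<in> AAA_param"
    and \<rho>_pos: "\<rho> > 0"
    and y0_def: "y0 = base_fun U F h u0"
    and y0_le: "sup_norm y0 \<le> \<rho>"
    and L\<^sub>F_pos: "L\<^sub>F > 0" and L\<^sub>h_pos: "L\<^sub>h > 0"
    and h_lip: "\<And>x y. x \<in> Delta0 y0 \<rho> \<Longrightarrow> y \<in> Delta0 y0 \<rho> \<Longrightarrow>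
                  norm (h x - h y) \<le> L\<^sub>h * sup_norm (\<lambda>t. x t - y t)"
    and F_lip: "\<And>y x z w t. y \<in> Delta0 y0 \<rho> \<Longrightarrow> x \<in> Delta0 y0 \<rho> \<Longrightarrow>
                  z \<in> Delta0 y0 \<rho> \<union> kernel_op B ` Delta0 y0 \<rho> \<Longrightarrow>
                  w \<in> Delta0 y0 \<rho> \<union> kernel_op B ` Delta0 y0 \<rho> \<Longrightarrow> 0 \<le> t \<Longrightarrow>
                  norm (F t (y t, z t) - F t (x t, w t))
                    \<le> L\<^sub>F * (norm (y t - x t) + norm (z t - w t))"
    and B_int: "\<And>u t. u \<in> Delta0 y0 \<rho> \<Longrightarrow> 0 \<le> t \<Longrightarrow>
                  (\<lambda>s. blinfun_apply (B t s) (u s)) integrable_on {0..t}"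
    and UF_int: "\<And>u t. u \<in> Delta0 y0 \<rho> \<Longrightarrow> 0 \<le> t \<Longrightarrow>
                  (\<lambda>s. blinfun_apply (U t s) (F s (u s, kernel_op B u s))) integrable_on {0..t}"
    and small: "M * L\<^sub>h + M / \<delta> * (1 + kernel_const B) * L\<^sub>F \<le> \<rho> / (\<rho> + sup_norm y0)"
  shows "\<exists>!u. u \<in> Delta0 y0 \<rho> \<and> mild_solution U B F h u0 u"
proof -
  let ?\<Delta> = "Delta0 y0 \<rho>" and ?z = "\<lambda>t::real\<in>{0..}. 0 :: 'a"
  define c where "c = kernel_const B"
  define \<Gamma> where "\<Gamma> u = (\<lambda>t\<in>{0..}. blinfun_apply (U t 0) (u0 + h u)
      + integral {0..t} (\<lambda>s. blinfun_apply (U t s) (F s (u s, kernel_op B u s))))" for u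
  have \<Delta>_AAA: "u \<in> AAA" if "u \<in> ?\<Delta>" for u
    using that by (simp add: Delta0_def)
  have c: "integral {0..s} (\<lambda>\<tau>. norm (B s \<tau>)) \<le> c" if "0 \<le> s" for s
    unfolding c_def kernel_const_def using B_const that by (intro cSUP_upper) auto
  have c0: "0 \<le> c" using c[of 0] by simp
  have Kz: "kernel_op B ?z = ?z"
  proof
    fix t
    have "integral {0..t} (\<lambda>s. blinfun_apply (B t s) (?z s)) = integral {0..t} (\<lambda>s. 0)"
      by (rule Henstock_Kurzweil_Integration.integral_cong) simp
    then show "kernel_op B ?z t = ?z t" by (simp add: kernel_op_def restrict_def)
  qed
  have y0_\<Gamma>: "y0 = \<Gamma> ?z"
  proof
    fix t
    have "integral {0..t} (\<lambda>s. blinfun_apply (U t s) (F s (0, 0)))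
        = integral {0..t} (\<lambda>s. blinfun_apply (U t s) (F s (?z s, kernel_op B ?z s)))"
      unfolding Kz by (rule Henstock_Kurzweil_Integration.integral_cong) simp
    then show "y0 t = \<Gamma> ?z t" by (simp add: y0_def base_fun_def \<Gamma>_def restrict_def)
  qed
  \<comment> \<open>The hypothesis \<open>y0_le\<close> places the zero function in
    \<open>Delta0\<close>, so the Lipschitz bounds may be used against it.\<close>
  have "sup_norm (\<lambda>t. ?z t - y0 t) = sup_norm y0"
    unfolding sup_norm_def by (rule SUP_cong) simp_all
  then have z: "?z \<in> ?\<Delta>" using y0_le AAA_zero by (simp add: Delta0_def)

  \<comment> \<open>\<open>N\<close> is any pointwise bound, so it can be the supremum norm of
    \<open>u - v\<close> or the constant \<open>Ku\<close> when \<open>v\<close> is the zero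
    function.\<close>
  have kernel_diff: "norm (kernel_op B u t - kernel_op B v t) \<le> c * N"
    if u: "u \<in> ?\<Delta>" and v: "v \<in> ?\<Delta>" and t: "0 \<le> t" and N: "\<And>s. 0 \<le> s \<Longrightarrow> norm (u s - v s) \<le> N" for u v t N
  proof -
    have N0: "0 \<le> N" using norm_ge_zero N[of 0] by (metis order_refl order_trans)
    have "kernel_op B u t - kernel_op B v t
        = integral {0..t} (\<lambda>s. blinfun_apply (B t s) (u s) - blinfun_apply (B t s) (v s))"
      using t by (simp add: kernel_op_def Henstock_Kurzweil_Integration.integral_diff B_int u v)
    also have "norm \<dots> \<le> integral {0..t} (\<lambda>s. norm (B t s) * N)"
    proof (rule Henstock_Kurzweil_Integration.integral_norm_bound_integral)
      show "(\<lambda>s. blinfun_apply (B t s) (u s) - blinfun_apply (B t s) (v s)) integrable_on {0..t}"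
        by (intro integrable_diff B_int u v t)
      show "(\<lambda>s. norm (B t s) * N) integrable_on {0..t}"
        by (rule integrable_on_mult_left[OF B_norm_int[OF t]])
      fix s assume "s \<in> {0..t}"
      then have "norm (B t s) * norm (u s - v s) \<le> norm (B t s) * N"
        using N by (intro mult_left_mono) auto
      with norm_blinfun[of "B t s" "u s - v s"]
      show "norm (blinfun_apply (B t s) (u s) - blinfun_apply (B t s) (v s)) \<le> norm (B t s) * N"
        by (simp add: blinfun.diff_right)
    qed
    also have "\<dots> \<le> c * N" using c[OF t] N0 by (simp add: mult_right_mono)
    finally show ?thesis .
  qed
  have F_diff: "norm (F t (u t, kernel_op B u t) - F t (v t, kernel_op B v t)) \<le> L\<^sub>F * ((1 + c) * N)"
    if u: "u \<in> ?\<Delta>" and v: "v \<in> ?\<Delta>" and t: "0 \<le> t" and N: "\<And>s. 0 \<le> s \<Longrightarrow> norm (u s - v s) \<le> N" for u v t N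
  proof -
    \<comment> \<open>\<open>F_lip\<close> is used with images under \<open>kernel_op B\<close> as
      second components, which may lie outside \<open>Delta0\<close>.\<close>
    have "norm (F t (u t, kernel_op B u t) - F t (v t, kernel_op B v t))
        \<le> L\<^sub>F * (norm (u t - v t) + norm (kernel_op B u t - kernel_op B v t))"
      using u v t by (intro F_lip) auto
    also have "\<dots> \<le> L\<^sub>F * (N + c * N)"
      using L\<^sub>F_pos N[OF t] kernel_diff[OF u v t N] by (intro mult_left_mono) auto
    finally show ?thesis by (simp add: algebra_simps)
  qed

  have \<Gamma>_AAA: "\<Gamma> u \<in> AAA" if u: "u \<in> ?\<Delta>" for u
  proof -
    have uA: "u \<in> AAA" using \<Delta>_AAA[OF u] .
    obtain x \<psi> where x: "x \<in> AA" and \<psi>: "\<psi> \<in> C0" and u_eq: "\<And>t. t \<ge> 0 \<Longrightarrow> u t = x t + \<psi> t"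
      using uA by (auto simp: AAA_def)
    obtain a where a: "a \<in> AA"
      and lim_a0: "((\<lambda>t. integral {0..t} (\<lambda>s. blinfun_apply (B t s) (u s)) - a t) \<longlongrightarrow> 0) at_top"
      using kernel_asymptotically_AA[OF B_decomp uA B_int[OF u]] by blast
    have lim_a: "((\<lambda>t. kernel_op B u t - a t) \<longlongrightarrow> 0) at_top"
      by (rule Lim_transform_eventually[OF lim_a0])
        (use eventually_ge_at_top[of 0] in \<open>eventually_elim, simp add: kernel_op_def\<close>)
    have lim_x: "((\<lambda>t. u t - x t) \<longlongrightarrow> 0) at_top"
    proof (rule Lim_transform_eventually)
      show "(\<psi> \<longlongrightarrow> 0) at_top" using \<psi> by (simp add: C0_def)
      show "\<forall>\<^sub>F t in at_top. \<psi> t = u t - x t"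
        using eventually_ge_at_top[of 0] by eventually_elim (simp add: u_eq)
    qed
    obtain f \<phi> where f: "f \<in> AA_param" and \<phi>: "\<phi> \<in> C0_param"
      and F_eq: "\<And>t y. t \<ge> 0 \<Longrightarrow> F t y = f t y + \<phi> t y"
      using F_AAA by (auto simp: AAA_param_def)
    let ?y = "\<lambda>t. (u t, kernel_op B u t)"
    obtain Ku where Ku: "\<And>t. t \<ge> 0 \<Longrightarrow> norm (u t) \<le> Ku" using AAA_bound[OF uA] by blast
    have uz: "norm (u t - ?z t) \<le> Ku" if "0 \<le> t" for t
      using Ku[OF that] that by simp
    have Kk: "norm (kernel_op B u t) \<le> c * Ku" if "0 \<le> t" for t
      using kernel_diff[OF u z that uz] that unfolding Kz by simp
    have y_le: "norm (?y t) \<le> Ku + c * Ku" if "0 \<le> t" for t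
      using norm_Pair_le[of "u t" "kernel_op B u t"] Ku[OF that] Kk[OF that] by simp
    have "((\<lambda>t. ?y t - (x t, a t)) \<longlongrightarrow> 0) at_top"
      using tendsto_Pair[OF lim_x lim_a] by (simp add: zero_prod_def)
    from tendsto_add[OF AA_compose_perturb[OF f AA_Pair[OF x a] this] C0_param_tendsto[OF \<phi> y_le]]
    have lim_F: "((\<lambda>t. f t (?y t) - f t (x t, a t) + \<phi> t (?y t)) \<longlongrightarrow> 0) at_top" by simp
    have lim_G: "((\<lambda>t. F t (?y t) - f t (x t, a t)) \<longlongrightarrow> 0) at_top"
      by (rule Lim_transform_eventually[OF lim_F])
        (use eventually_ge_at_top[of 0] in \<open>eventually_elim, simp add: F_eq\<close>)
    have "bounded (range (\<lambda>(t, y). f t y))" using f by (simp add: AA_param_def)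
    then obtain Kf where Kf: "\<And>t y. norm (f t y) \<le> Kf" unfolding bounded_iff by auto
    \<comment> \<open>Membership of \<open>\<phi>\<close> in \<open>C0_param\<close> gives no bound
      at finite times along a discontinuous curve. \<open>F\<close> is therefore bounded at
      \<open>(0, 0)\<close>, where \<open>\<phi>\<close> is a \<open>C0\<close> function, and the
      Lipschitz estimate transports the bound to \<open>(u, Bu)\<close>.\<close>
    have "(\<lambda>t. \<phi> t (0, 0)) \<in> C0"
      by (rule C0_param_compose[OF \<phi>, of "\<lambda>_. (0, 0)" 0]) (simp_all add: zero_prod_def[symmetric])
    then obtain K\<phi> where K\<phi>: "\<And>t. 0 \<le> t \<Longrightarrow> norm (\<phi> t (0, 0)) \<le> K\<phi>" using C0_bound by blast
    have F_le: "norm (F t (?y t)) \<le> L\<^sub>F * ((1 + c) * Ku) + (Kf + K\<phi>)" if t: "0 \<le> t" for t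
    proof -
      have "norm (F t (?y t) - F t (0, 0)) \<le> L\<^sub>F * ((1 + c) * Ku)"
        using F_diff[OF u z t uz] t unfolding Kz by simp
      moreover have "norm (F t (0, 0)) \<le> Kf + K\<phi>"
        using norm_triangle_ineq[of "f t (0, 0)" "\<phi> t (0, 0)"] Kf[of t "(0, 0)"] K\<phi>[OF t] F_eq[OF t] by simp
      ultimately show ?thesis using norm_triangle_sub[of "F t (?y t)" "F t (0, 0)"] by simp
    qed
    show ?thesis
      unfolding \<Gamma>_def
      by (rule evolution_convolution_AAA[OF U_evol U_bi_aa M_pos \<delta>_pos U_exp
            AA_compose[OF f AA_Pair[OF x a]] lim_G F_le UF_int[OF u]])
  qed

  define \<alpha> where "\<alpha> = M * L\<^sub>h"
  define \<beta> where "\<beta> = M / \<delta> * (1 + c) * L\<^sub>F"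
  define q where "q = max \<alpha> \<beta>"
  \<comment> \<open>Boundedness of \<open>y0\<close> comes from
    \<open>\<Gamma> ?z \<in> AAA\<close>; with it \<open>sup_norm y0\<close> is an actual supremum
    that dominates the pointwise norms.\<close>
  obtain K0 where K0: "\<And>t. 0 \<le> t \<Longrightarrow> norm (y0 t) \<le> K0"
    using AAA_bound[OF \<Gamma>_AAA[OF z]] y0_\<Gamma> by auto
  have y0_norm: "norm (y0 t) \<le> sup_norm y0" if "0 \<le> t" for t
    by (rule norm_le_sup_norm[OF K0 that])
  have Y: "0 \<le> sup_norm y0" using norm_ge_zero y0_norm[of 0] by (metis order_refl order_trans)
  have pos: "\<alpha> > 0" "\<beta> > 0"
    using M_pos L\<^sub>h_pos L\<^sub>F_pos \<delta>_pos c0 by (auto simp: \<alpha>_def \<beta>_def)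
  have sum: "\<alpha> + \<beta> \<le> \<rho> / (\<rho> + sup_norm y0)"
    using small by (simp add: \<alpha>_def \<beta>_def c_def)
  also have "\<dots> \<le> 1" using \<rho>_pos Y by simp
  finally have "\<alpha> + \<beta> \<le> 1" .
  \<comment> \<open>Both numbers are positive with sum at most 1, hence each is below 1.\<close>
  then have q: "0 \<le> q" "q < 1" using pos by (auto simp: q_def)
  \<comment> \<open>The maximum is at most the sum, so the smallness condition applies to
    \<open>q\<close>. Elements of \<open>Delta0\<close> are at distance at most
    \<open>\<rho> + sup_norm y0\<close> from the zero function, so this inequality is what
    invariance needs.\<close>
  have q_self: "q * (\<rho> + sup_norm y0) \<le> \<rho>"
  proof -
    have "q \<le> \<rho> / (\<rho> + sup_norm y0)" using sum pos by (simp add: q_def)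
    then show ?thesis using \<rho>_pos Y by (simp add: pos_le_divide_eq)
  qed

  text \<open>At time \<open>t\<close> the two contributions \<open>\<alpha>\<close> and \<open>\<beta>\<close> carry the weights \<open>e\<^sup>-\<^sup>\<delta>\<^sup>t\<close> and
    \<open>1 - e\<^sup>-\<^sup>\<delta>\<^sup>t\<close>. This gives the contraction constant \<open>max \<alpha> \<beta>\<close>, which is below \<open>1\<close> even in the
    case \<open>y0 = 0\<close>, where \<open>\<alpha> + \<beta> = 1\<close> is allowed.\<close>
  have contr: "norm (\<Gamma> u t - \<Gamma> v t) \<le> q * sup_norm (\<lambda>t. u t - v t)"
    if u: "u \<in> ?\<Delta>" and v: "v \<in> ?\<Delta>" and t: "0 \<le> t" for u v t
  proof -
    define N where "N = sup_norm (\<lambda>t. u t - v t)"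
    have N: "norm (u s - v s) \<le> N" if "0 \<le> s" for s
      unfolding N_def by (rule norm_diff_le_sup_norm[OF \<Delta>_AAA[OF u] \<Delta>_AAA[OF v] that])
    have N0: "0 \<le> N" using norm_ge_zero N[of 0] by (metis order_refl order_trans)
    define w where "w = exp (- \<delta> * t)"
    have w: "0 \<le> w" "w \<le> 1" using t \<delta>_pos by (simp_all add: w_def)
    let ?G = "\<lambda>u s. F s (u s, kernel_op B u s)"
    have U_le: "norm (blinfun_apply (U t s) y) \<le> M * exp (- \<delta> * (t - s)) * norm y" if "0 \<le> s" "s \<le> t" for s y
      using norm_blinfun[of "U t s" y] mult_right_mono[OF U_exp[OF that] norm_ge_zero[of y]] by simp
    have "norm (blinfun_apply (U t 0) (h u - h v)) \<le> M * w * norm (h u - h v)"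
      using U_le[of 0 "h u - h v"] t by (simp add: w_def)
    also have "\<dots> \<le> M * w * (L\<^sub>h * N)"
      using h_lip[OF u v] M_pos w by (intro mult_left_mono) (auto simp: N_def)
    finally have 1: "norm (blinfun_apply (U t 0) (h u - h v)) \<le> w * \<alpha> * N"
      by (simp add: \<alpha>_def mult_ac)
    have "norm (integral {0..t} (\<lambda>s. blinfun_apply (U t s) (?G u s) - blinfun_apply (U t s) (?G v s)))
        \<le> integral {0..t} (\<lambda>s. M * (L\<^sub>F * ((1 + c) * N)) * exp (- \<delta> * (t - s)))"
    proof (rule Henstock_Kurzweil_Integration.integral_norm_bound_integral)
      show "(\<lambda>s. blinfun_apply (U t s) (?G u s) - blinfun_apply (U t s) (?G v s)) integrable_on {0..t}"
        by (intro integrable_diff UF_int u v t)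
      show "(\<lambda>s. M * (L\<^sub>F * ((1 + c) * N)) * exp (- \<delta> * (t - s))) integrable_on {0..t}"
        by (intro integrable_continuous_interval continuous_intros)
      fix s assume "s \<in> {0..t}"
      then have s: "0 \<le> s" "s \<le> t" by auto
      have "norm (blinfun_apply (U t s) (?G u s - ?G v s)) \<le> M * exp (- \<delta> * (t - s)) * norm (?G u s - ?G v s)"
        by (rule U_le[OF s])
      also have "\<dots> \<le> M * exp (- \<delta> * (t - s)) * (L\<^sub>F * ((1 + c) * N))"
        using F_diff[OF u v s(1) N] M_pos by (intro mult_left_mono) auto
      finally show "norm (blinfun_apply (U t s) (?G u s) - blinfun_apply (U t s) (?G v s))
          \<le> M * (L\<^sub>F * ((1 + c) * N)) * exp (- \<delta> * (t - s))"
        by (simp add: blinfun.diff_right mult_ac)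
    qed
    \<comment> \<open>The integral is evaluated exactly: the estimate \<open>1 / \<delta>\<close>
      would lose the weight \<open>1 - w\<close>, and with it strict contraction when
      \<open>\<alpha> + \<beta> = 1\<close>.\<close>
    also have "\<dots> = M * (L\<^sub>F * ((1 + c) * N)) * ((exp (- \<delta> * (t - t)) - exp (- \<delta> * (t - 0))) / \<delta>)"
      using t \<delta>_pos by (intro integral_unique has_integral_mult_right has_integral_exp_decay) auto
    also have "\<dots> = (1 - w) * \<beta> * N"
      by (simp add: \<beta>_def w_def mult_ac)
    finally have 2: "norm (integral {0..t} (\<lambda>s. blinfun_apply (U t s) (?G u s) - blinfun_apply (U t s) (?G v s)))
        \<le> (1 - w) * \<beta> * N" .
    have "\<Gamma> u t - \<Gamma> v t = blinfun_apply (U t 0) (h u - h v)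
        + integral {0..t} (\<lambda>s. blinfun_apply (U t s) (?G u s) - blinfun_apply (U t s) (?G v s))"
      using t by (simp add: \<Gamma>_def Henstock_Kurzweil_Integration.integral_diff UF_int u v
          blinfun.diff_right blinfun.add_right)
    then have "norm (\<Gamma> u t - \<Gamma> v t) \<le> w * \<alpha> * N + (1 - w) * \<beta> * N"
      using 1 2 norm_triangle_mono by simp
    also have "\<dots> \<le> w * q * N + (1 - w) * q * N"
      using w N0 by (intro add_mono mult_right_mono mult_left_mono) (auto simp: q_def)
    also have "\<dots> = q * N" by (simp add: algebra_simps)
    finally show ?thesis by (simp add: N_def)
  qed

  have \<Delta>_near: "norm (u t - y0 t) \<le> \<rho>" if u: "u \<in> ?\<Delta>" and t: "0 \<le> t" for u t
  proof -
    have "norm (u t - y0 t) \<le> sup_norm (\<lambda>t. u t - y0 t)"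
      using \<Delta>_AAA[OF u] \<Gamma>_AAA[OF z] t unfolding y0_\<Gamma>[symmetric] by (rule norm_diff_le_sup_norm)
    also have "\<dots> \<le> \<rho>" using u by (simp add: Delta0_def)
    finally show ?thesis .
  qed
  have maps: "\<Gamma> u \<in> ?\<Delta>" if u: "u \<in> ?\<Delta>" for u
  proof -
    have "sup_norm (\<lambda>t. u t - ?z t) \<le> \<rho> + sup_norm y0"
    proof (rule sup_norm_le)
      fix t :: real assume t: "0 \<le> t"
      show "norm (u t - ?z t) \<le> \<rho> + sup_norm y0"
        using \<Delta>_near[OF u t] y0_norm[OF t] norm_triangle_sub[of "u t" "y0 t"] t by simp
    qed
    from mult_left_mono[OF this q(1)]
    have "norm (\<Gamma> u t - y0 t) \<le> \<rho>" if "0 \<le> t" for t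
      using contr[OF u z that] q_self unfolding y0_\<Gamma>[symmetric] by simp
    then have "sup_norm (\<lambda>t. \<Gamma> u t - y0 t) \<le> \<rho>" by (rule sup_norm_le)
    then show ?thesis using \<Gamma>_AAA[OF u] by (simp add: Delta0_def)
  qed
  have closed: "v \<in> ?\<Delta>"
    if u: "\<And>n. u n \<in> ?\<Delta>" and lim: "uniform_limit {0..} u v sequentially" and v: "v \<in> extensional {0..}"
    for u :: "nat \<Rightarrow> real \<Rightarrow> 'a" and v
  proof -
    have "norm (v t - y0 t) \<le> \<rho>" if t: "0 \<le> t" for t
    proof (rule Lim_bounded)
      show "(\<lambda>n. norm (u n t - y0 t)) \<longlonglongrightarrow> norm (v t - y0 t)"
        using t by (intro tendsto_intros tendsto_uniform_limitI[OF lim]) auto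
      show "\<forall>n\<ge>0. norm (u n t - y0 t) \<le> \<rho>" using \<Delta>_near[OF u t] by blast
    qed
    then have "sup_norm (\<lambda>t. v t - y0 t) \<le> \<rho>" by (rule sup_norm_le)
    then show ?thesis
      using AAA_uniform_limit[OF \<Delta>_AAA[OF u] lim v] by (simp add: Delta0_def)
  qed
  have "\<exists>!u. u \<in> ?\<Delta> \<and> \<Gamma> u = u"
    using z by (intro AAA_fixed_point[OF _ _ closed maps q contr]) (auto dest: \<Delta>_AAA)
  \<comment> \<open>Off \<open>[0, \<infinity>)\<close> both sides of the fixed point equation are
    \<open>undefined\<close>, since members of \<open>AAA\<close> are extensional. The integrability
    demanded of a mild solution is supplied by \<open>B_int\<close> and
    \<open>UF_int\<close>.\<close>
  moreover have "mild_solution U B F h u0 u \<longleftrightarrow> \<Gamma> u = u" if u: "u \<in> ?\<Delta>" for u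
  proof
    have ext: "u \<in> extensional {0..}" using \<Delta>_AAA[OF u] by (simp add: AAA_def)
    assume mild: "mild_solution U B F h u0 u"
    show "\<Gamma> u = u"
      by (rule extensionalityI[OF _ ext]) (use mild in \<open>auto simp: \<Gamma>_def mild_solution_def\<close>)
  next
    assume fp: "\<Gamma> u = u"
    have "u t = blinfun_apply (U t 0) (u0 + h u)
        + integral {0..t} (\<lambda>s. blinfun_apply (U t s) (F s (u s, kernel_op B u s)))" if "0 \<le> t" for t
      using fun_cong[OF fp, of t] that by (simp add: \<Gamma>_def)
    then show "mild_solution U B F h u0 u"
      unfolding mild_solution_def using AAA_continuous[OF \<Delta>_AAA[OF u]] B_int[OF u] UF_int[OF u] by blast
  qed
  ultimately show ?thesis by (metis (no_types, lifting))
qed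

end
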